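(* Every homeomorphism $f:S^1\to S^1$ of the circle belongs to one of the following three categories: (i) $f$ has entropy numbers $(0,0)$ and it is Lyapunov stable; or (ii) $f$ has entropy numbers $(0,[n])$, it is not Lyapunov stable and it has periodic points; or (iii) $f$ has entropy numbers $([n],[n])$ and it is a Denjoy map. In particular, in the space of homeomorphisms of the circle, Denjoy maps are more dispersive than Morse–Smale maps, which are more dispersive than rotations.
   Context: Orders of growth. Let $\mathbb{N}=\{1,2,\dots\}$ and let $\mathcal{O}$ be the set of non-decreasing sequences $a:\mathbb{N}\to[0,\infty)$. For $a_1,a_2\in\mathcal{O}$ write $a_1\approx a_2$ if there are $c,C\in(0,\infty)$ with $c\,a_1(n)\le a_2(n)\le C\,a_1(n)$ for all $n$. Let $\mathbb{O}=\mathcal{O}/{\approx}$, and let $[a(n)]\in\mathbb{O}$ denote the class of $a$; e.g. $[n]$ is the class of $a(n)=n$. Partially order $\mathbb{O}$ by: $[a_1(n)]\le[a_2(n)]$ iff there is $C>0$ with $a_1(n)\le C\,a_2(n)$ for all $n$. Let $\overline{\mathbb{O}}$ be the Dedekind–MacNeille completion of $(\mathbb{O},\le)$ (the smallest complete lattice containing $\mathbb{O}$), so $\mathbb{O}\subset\overline{\mathbb{O}}$. The symbol $0\in\mathbb{O}$ denotes the class of the constant sequence $a(n)=1$. As usual $o_1>o_2$ means $o_1\ge o_2$ and $o_1\ne o_2$. Generalized topological entropy. For a compact metric space $(M,d)$ and a continuous map $f:M\to M$, put $d_n(x,y)=\max\{d(f^i(x),f^i(y)):0\le i\le n\}$ and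 $B(x,n,\epsilon)=\{y\in M:d_n(x,y)\le\epsilon\}$. Let $g_{f,\epsilon}(n)$ be the minimal cardinality of a finite set $E\subset M$ with $M=\bigcup_{x\in E}B(x,n,\epsilon)$. Then $g_{f,\epsilon}\in\mathcal{O}$, and $o(f)=\sup\{[g_{f,\epsilon}(n)]:\epsilon>0\}\in\overline{\mathbb{O}}$. Let $\Omega(f)$ be the non-wandering set of $f$. The entropy numbers of $f$ are the pair $(o(f_{|\Omega(f)}),o(f))$. A map $f$ is more dispersive than $g$ if either $o(f_{|\Omega(f)})>o(g_{|\Omega(g)})$, or $o(f_{|\Omega(f)})=o(g_{|\Omega(g)})$ and $o(f)>o(g)$. $f$ is Lyapunov stable if for every $\epsilon>0$ there is $\delta>0$ such that $d(x,y)<\delta$ implies $d(f^n(x),f^n(y))<\epsilon$ for all $n\in\mathbb{N}$. A Denjoy map is an orientation-preserving homeomorphism of $S^1$ with irrational rotation number which is semi-conjugate but not conjugate to the corresponding irrational rotation. A Morse–Smale map of $S^1$ is one whose non-wandering set consists only of a finite number of hyperbolic periodic points. *)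

theory Defs
  imports "HOL-Analysis.Analysis"
begin

section \<open>Orders of growth\<close>

text \<open>
  The natural numbers start at 1 here: a sequence is a function on \<^typ>\<open>nat\<close> whose value at 0
  is irrelevant. Sequences which agree from 1 onwards are identified in the quotient.
\<close>

definition growth_seqs :: "(nat \<Rightarrow> real) set" where
  "growth_seqs = {a. mono_on {1..} a \<and> (\<forall>n\<ge>1. 0 \<le> a n)}"

definition growth_equiv :: "(nat \<Rightarrow> real) \<Rightarrow> (nat \<Rightarrow> real) \<Rightarrow> bool" where
  "growth_equiv a b \<longleftrightarrow> a \<in> growth_seqs \<and> b \<in> growth_seqs \<and>
     (\<exists>c>0. \<exists>C>0. \<forall>n\<ge>1. c * a n \<le> b n \<and> b n \<le> C * a n)"

definition growth_le :: "(nat \<Rightarrow> real) \<Rightarrow> (nat \<Rightarrow> real) \<Rightarrow> bool" where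
  "growth_le a b \<longleftrightarrow> (\<exists>C>0. \<forall>n\<ge>1. a n \<le> C * b n)"

lemma growth_le_refl: "growth_le a a"
  unfolding growth_le_def by (intro exI[of _ 1]) auto

lemma growth_le_trans:
  assumes "growth_le a b" "growth_le b c"
  shows "growth_le a c"
proof -
  obtain C where C: "C > 0" "\<And>n. n \<ge> 1 \<Longrightarrow> a n \<le> C * b n"
    using assms(1) by (auto simp: growth_le_def)
  obtain D where D: "D > 0" "\<And>n. n \<ge> 1 \<Longrightarrow> b n \<le> D * c n"
    using assms(2) by (auto simp: growth_le_def)
  have "a n \<le> (C * D) * c n" if "n \<ge> 1" for n
  proof -
    have "C * b n \<le> C * (D * c n)"
      using C(1) D(2)[OF that] by (intro mult_left_mono) auto
    with C(2)[OF that] show ?thesis by (simp add: mult.assoc)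
  qed
  moreover have "C * D > 0" using C(1) D(1) by simp
  ultimately show ?thesis unfolding growth_le_def by blast
qed

lemma growth_equiv_iff:
  "growth_equiv a b \<longleftrightarrow>
     a \<in> growth_seqs \<and> b \<in> growth_seqs \<and> growth_le a b \<and> growth_le b a"
proof -
  have "(\<exists>c>0. \<forall>n\<ge>1. c * a n \<le> b n) \<longleftrightarrow> growth_le a b"
  proof
    assume "\<exists>c>0. \<forall>n\<ge>1. c * a n \<le> b n"
    then obtain c where c: "c > 0" "\<forall>n\<ge>1. c * a n \<le> b n" by blast
    then have "\<forall>n\<ge>1. a n \<le> inverse c * b n"
      by (auto simp: field_simps)
    with c(1) show "growth_le a b"
      unfolding growth_le_def by (intro exI[of _ "inverse c"]) auto
  next
    assume "growth_le a b"
    then obtain C where C: "C > 0" "\<forall>n\<ge>1. a n \<le> C * b n" by (auto simp: growth_le_def)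
    then have "\<forall>n\<ge>1. inverse C * a n \<le> b n"
      by (auto simp: field_simps)
    with C(1) show "\<exists>c>0. \<forall>n\<ge>1. c * a n \<le> b n"
      by (intro exI[of _ "inverse C"]) auto
  qed
  then show ?thesis
    unfolding growth_equiv_def growth_le_def by blast
qed

lemma const_in_growth_seqs: "0 \<le> c \<Longrightarrow> (\<lambda>_. c) \<in> growth_seqs"
  by (auto simp: growth_seqs_def mono_on_def)

quotient_type growth_order = "nat \<Rightarrow> real" / partial: growth_equiv
  morphisms rep_growth_order growth_class
proof (rule part_equivpI)
  show "\<exists>a. growth_equiv a a"
    using const_in_growth_seqs[of 1] growth_le_refl by (auto simp: growth_equiv_iff)
  show "symp growth_equiv"
    by (auto intro!: sympI simp: growth_equiv_iff)
  show "transp growth_equiv"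
    by (auto intro!: transpI intro: growth_le_trans simp: growth_equiv_iff)
qed

instantiation growth_order :: order
begin

lift_definition less_eq_growth_order :: "growth_order \<Rightarrow> growth_order \<Rightarrow> bool" is growth_le
  by (auto simp: growth_equiv_iff intro: growth_le_trans)

definition less_growth_order :: "growth_order \<Rightarrow> growth_order \<Rightarrow> bool" where
  "x < y \<longleftrightarrow> x \<le> y \<and> \<not> y \<le> (x :: growth_order)"

instance
proof
  fix x y z :: growth_order
  show "x < y \<longleftrightarrow> x \<le> y \<and> \<not> y \<le> x"
    by (rule less_growth_order_def)
  show "x \<le> x"
    by transfer (rule growth_le_refl)
  show "x \<le> z" if "x \<le> y" "y \<le> z"
    using that by transfer (rule growth_le_trans)
  show "x = y" if "x \<le> y" "y \<le> x"
    using that by transfer (auto simp: growth_equiv_iff)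
qed

end

lemma growth_class_le_iff:
  assumes "a \<in> growth_seqs" "b \<in> growth_seqs"
  shows "growth_class a \<le> growth_class b \<longleftrightarrow> growth_le a b"
  using assms
  by (intro less_eq_growth_order.abs_eq) (auto simp: growth_equiv_iff growth_le_refl)


section \<open>The Dedekind--MacNeille completion\<close>

definition uppers :: "'a::order set \<Rightarrow> 'a set" where
  "uppers A = {u. \<forall>x\<in>A. x \<le> u}"

definition lowers :: "'a::order set \<Rightarrow> 'a set" where
  "lowers A = {l. \<forall>x\<in>A. l \<le> x}"

lemma uppers_antimono: "A \<subseteq> B \<Longrightarrow> uppers B \<subseteq> uppers A"
  by (auto simp: uppers_def)

lemma lowers_antimono: "A \<subseteq> B \<Longrightarrow> lowers B \<subseteq> lowers A"
  by (auto simp: lowers_def)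

lemma subset_lowers_uppers: "A \<subseteq> lowers (uppers A)"
  by (auto simp: lowers_def uppers_def)

lemma lowers_uppers_lowers: "lowers (uppers (lowers A)) = lowers A"
  by (auto simp: lowers_def uppers_def)

typedef growth_completion = "{A :: growth_order set. lowers (uppers A) = A}"
  morphisms cut_of Cut
  by (rule exI[of _ "lowers {}"]) (simp add: lowers_uppers_lowers)

setup_lifting type_definition_growth_completion

lemma cut_Inter:
  assumes "\<And>A. A \<in> \<A> \<Longrightarrow> lowers (uppers A) = A"
  shows "lowers (uppers (\<Inter>\<A>)) = \<Inter>\<A>"
proof
  show "lowers (uppers (\<Inter>\<A>)) \<subseteq> \<Inter>\<A>"
  proof
    fix x assume x: "x \<in> lowers (uppers (\<Inter>\<A>))"
    show "x \<in> \<Inter>\<A>"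
    proof
      fix A assume A: "A \<in> \<A>"
      then have "lowers (uppers (\<Inter>\<A>)) \<subseteq> lowers (uppers A)"
        by (intro lowers_antimono uppers_antimono) auto
      with x assms[OF A] show "x \<in> A" by blast
    qed
  qed
qed (rule subset_lowers_uppers)

instantiation growth_completion :: complete_lattice
begin

lift_definition less_eq_growth_completion :: "growth_completion \<Rightarrow> growth_completion \<Rightarrow> bool"
  is "(\<subseteq>)" .

lift_definition less_growth_completion :: "growth_completion \<Rightarrow> growth_completion \<Rightarrow> bool"
  is "(\<subset>)" .

lift_definition Inf_growth_completion :: "growth_completion set \<Rightarrow> growth_completion"
  is Inter by (rule cut_Inter)

lift_definition Sup_growth_completion :: "growth_completion set \<Rightarrow> growth_completion"
  is "\<lambda>\<A>. lowers (uppers (\<Union>\<A>))" by (rule lowers_uppers_lowers)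

lift_definition inf_growth_completion ::
    "growth_completion \<Rightarrow> growth_completion \<Rightarrow> growth_completion"
  is "(\<inter>)" subgoal for A B using cut_Inter[of "{A, B}"] by auto done

lift_definition sup_growth_completion ::
    "growth_completion \<Rightarrow> growth_completion \<Rightarrow> growth_completion"
  is "\<lambda>A B. lowers (uppers (A \<union> B))" by (rule lowers_uppers_lowers)

lift_definition bot_growth_completion :: growth_completion
  is "lowers UNIV" using lowers_uppers_lowers .

lift_definition top_growth_completion :: growth_completion
  is UNIV by (auto simp: lowers_def uppers_def)

instance
proof
  fix x y z :: growth_completion and A :: "growth_completion set"
  show "x < y \<longleftrightarrow> x \<le> y \<and> \<not> y \<le> x" by transfer auto
  show "x \<le> x" by transfer auto
  show "x \<le> z" if "x \<le> y" "y \<le> z" using that by transfer auto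
  show "x = y" if "x \<le> y" "y \<le> x" using that by transfer auto
  show "inf x y \<le> x" "inf x y \<le> y" by (transfer; auto)+
  show "x \<le> inf y z" if "x \<le> y" "x \<le> z" using that by transfer auto
  show "x \<le> sup x y" by transfer (rule order_trans[OF _ subset_lowers_uppers], simp)
  show "y \<le> sup x y" by transfer (rule order_trans[OF _ subset_lowers_uppers], simp)
  show "sup y z \<le> x" if "y \<le> x" "z \<le> x"
    using that
  proof transfer
    fix A B C :: "growth_order set"
    assume C: "lowers (uppers C) = C" and "B \<subseteq> C" "A \<subseteq> C"
    then have "lowers (uppers (A \<union> B)) \<subseteq> lowers (uppers C)"
      by (intro lowers_antimono uppers_antimono) auto
    then show "lowers (uppers (A \<union> B)) \<subseteq> C" by (simp only: C)
  qed
  show "Inf A \<le> x" if "x \<in> A" using that by transfer auto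
  show "x \<le> Inf A" if "\<And>y. y \<in> A \<Longrightarrow> x \<le> y" using that by transfer auto
  show "x \<le> Sup A" if "x \<in> A"
    using that by transfer (rule order_trans[OF _ subset_lowers_uppers], rule Sup_upper)
  show "Sup A \<le> x" if "\<And>y. y \<in> A \<Longrightarrow> y \<le> x"
  proof -
    have "\<Union>(cut_of ` A) \<subseteq> cut_of x"
      using that by (auto simp: less_eq_growth_completion.rep_eq)
    then have "lowers (uppers (\<Union>(cut_of ` A))) \<subseteq> lowers (uppers (cut_of x))"
      by (intro lowers_antimono uppers_antimono)
    then show ?thesis
      using cut_of[of x] by (simp add: less_eq_growth_completion.rep_eq Sup_growth_completion.rep_eq)
  qed
  show "Inf {} = (top :: growth_completion)" by transfer auto
  show "Sup {} = (bot :: growth_completion)"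
    by transfer (auto simp: lowers_def uppers_def)
qed

end

definition dm_embed :: "growth_order \<Rightarrow> growth_completion" where
  "dm_embed x = Cut {y. y \<le> x}"

lemma cut_of_dm_embed: "cut_of (dm_embed x) = {y. y \<le> x}"
  unfolding dm_embed_def by (rule Cut_inverse) (auto simp: lowers_def uppers_def)

text \<open>
  The following facts characterise the completion among the complete lattices containing
  \<^typ>\<open>growth_order\<close> up to isomorphism.
\<close>

lemma dm_embed_le_iff: "dm_embed x \<le> dm_embed y \<longleftrightarrow> x \<le> y"
  by (auto simp: less_eq_growth_completion.rep_eq cut_of_dm_embed)

lemma dm_embed_eq_iff: "dm_embed x = dm_embed y \<longleftrightarrow> x = y"
  by (metis order.antisym order.refl dm_embed_le_iff)

lemma dm_embed_join_dense: "Sup (dm_embed ` {x. dm_embed x \<le> c}) = c"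
proof (rule antisym)
  show "Sup (dm_embed ` {x. dm_embed x \<le> c}) \<le> c"
    by (auto intro: Sup_least)
  show "c \<le> Sup (dm_embed ` {x. dm_embed x \<le> c})" (is "_ \<le> ?s")
  proof -
    have "x \<in> cut_of ?s" if "x \<in> cut_of c" for x
    proof -
      have cut: "lowers (uppers (cut_of c)) = cut_of c" using cut_of by auto
      have "{y. y \<le> x} \<subseteq> lowers (uppers (cut_of c))"
        using that by (auto simp: lowers_def uppers_def intro: order_trans)
      then have "dm_embed x \<le> c"
        by (simp add: cut less_eq_growth_completion.rep_eq cut_of_dm_embed)
      then have "dm_embed x \<le> ?s" by (auto intro: Sup_upper)
      then show ?thesis by (auto simp: less_eq_growth_completion.rep_eq cut_of_dm_embed)
    qed
    then show ?thesis by (auto simp: less_eq_growth_completion.rep_eq)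
  qed
qed

lemma dm_embed_meet_dense: "Inf (dm_embed ` {x. c \<le> dm_embed x}) = c"
proof (rule antisym)
  show "c \<le> Inf (dm_embed ` {x. c \<le> dm_embed x})"
    by (auto intro: Inf_greatest)
  show "Inf (dm_embed ` {x. c \<le> dm_embed x}) \<le> c" (is "?i \<le> _")
  proof -
    have "y \<in> cut_of c" if "y \<in> cut_of ?i" for y
    proof -
      have "y \<in> lowers (uppers (cut_of c))"
        unfolding lowers_def
      proof safe
        fix u assume "u \<in> uppers (cut_of c)"
        then have "c \<le> dm_embed u"
          by (auto simp: less_eq_growth_completion.rep_eq cut_of_dm_embed uppers_def)
        then have "?i \<le> dm_embed u" by (auto intro: Inf_lower)
        then show "y \<le> u"
          using that by (auto simp: less_eq_growth_completion.rep_eq cut_of_dm_embed)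
      qed
      then show ?thesis using cut_of[of c] by simp
    qed
    then show ?thesis by (auto simp: less_eq_growth_completion.rep_eq)
  qed
qed

abbreviation order_of :: "(nat \<Rightarrow> real) \<Rightarrow> growth_completion" where
  "order_of a \<equiv> dm_embed (growth_class a)"

text \<open>
  The order 0 is the class of the constant sequence 1. It is not the bottom element:
  the class of the constant sequence 0 lies strictly below it.
\<close>

definition order_zero :: growth_completion where
  "order_zero = order_of (\<lambda>_. 1)"

definition order_linear :: growth_completion where
  "order_linear = order_of (\<lambda>n. real n)"


section \<open>Generalized topological entropy\<close>

text \<open>
  A compact metric space is a compact set \<^term>\<open>M\<close> with the ambient distance, and a self-map of
  it is a function on the ambient type mapping \<^term>\<open>M\<close> into itself; only the values on
  \<^term>\<open>M\<close> matter. Restricting a map to an invariant set amounts to changing \<^term>\<open>M\<close>.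
\<close>

definition bowen_dist :: "('a::metric_space \<Rightarrow> 'a) \<Rightarrow> nat \<Rightarrow> 'a \<Rightarrow> 'a \<Rightarrow> real" where
  "bowen_dist f n x y = Max ((\<lambda>i. dist ((f ^^ i) x) ((f ^^ i) y)) ` {0..n})"

definition bowen_ball :: "'a::metric_space set \<Rightarrow> ('a \<Rightarrow> 'a) \<Rightarrow> 'a \<Rightarrow> nat \<Rightarrow> real \<Rightarrow> 'a set" where
  "bowen_ball M f x n \<epsilon> = {y \<in> M. bowen_dist f n x y \<le> \<epsilon>}"

definition spanning_number :: "'a::metric_space set \<Rightarrow> ('a \<Rightarrow> 'a) \<Rightarrow> real \<Rightarrow> nat \<Rightarrow> nat" where
  "spanning_number M f \<epsilon> n =
     (LEAST k. \<exists>E. finite E \<and> E \<subseteq> M \<and> card E = k \<and> M = (\<Union>x\<in>E. bowen_ball M f x n \<epsilon>))"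

definition gen_entropy :: "'a::metric_space set \<Rightarrow> ('a \<Rightarrow> 'a) \<Rightarrow> growth_completion" where
  "gen_entropy M f = Sup {order_of (\<lambda>n. real (spanning_number M f \<epsilon> n)) | \<epsilon>. \<epsilon> > 0}"

definition nonwandering :: "'a::metric_space set \<Rightarrow> ('a \<Rightarrow> 'a) \<Rightarrow> 'a set" where
  "nonwandering M f = {x \<in> M. \<forall>U. openin (top_of_set M) U \<and> x \<in> U \<longrightarrow>
     (\<exists>n\<ge>1. (f ^^ n) ` U \<inter> U \<noteq> {})}"

definition entropy_numbers ::
    "'a::metric_space set \<Rightarrow> ('a \<Rightarrow> 'a) \<Rightarrow> growth_completion \<times> growth_completion" where
  "entropy_numbers M f = (gen_entropy (nonwandering M f) f, gen_entropy M f)"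

definition more_dispersive ::
    "'a::metric_space set \<Rightarrow> ('a \<Rightarrow> 'a) \<Rightarrow> ('a \<Rightarrow> 'a) \<Rightarrow> bool" where
  "more_dispersive M f g \<longleftrightarrow>
     gen_entropy (nonwandering M f) f > gen_entropy (nonwandering M g) g \<or>
     gen_entropy (nonwandering M f) f = gen_entropy (nonwandering M g) g \<and>
       gen_entropy M f > gen_entropy M g"

definition lyapunov_stable :: "'a::metric_space set \<Rightarrow> ('a \<Rightarrow> 'a) \<Rightarrow> bool" where
  "lyapunov_stable M f \<longleftrightarrow> (\<forall>\<epsilon>>0. \<exists>\<delta>>0. \<forall>x\<in>M. \<forall>y\<in>M. dist x y < \<delta> \<longrightarrow>
     (\<forall>n\<ge>1. dist ((f ^^ n) x) ((f ^^ n) y) < \<epsilon>))"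

definition has_periodic_points :: "'a set \<Rightarrow> ('a \<Rightarrow> 'a) \<Rightarrow> bool" where
  "has_periodic_points M f \<longleftrightarrow> (\<exists>x\<in>M. \<exists>q\<ge>1. (f ^^ q) x = x)"


section \<open>Homeomorphisms of the circle\<close>

abbreviation circle :: "complex set" where
  "circle \<equiv> sphere 0 1"

definition circle_homeo :: "(complex \<Rightarrow> complex) \<Rightarrow> bool" where
  "circle_homeo f \<longleftrightarrow> (\<exists>g. homeomorphism circle circle f g)"

definition rotation :: "real \<Rightarrow> complex \<Rightarrow> complex" where
  "rotation \<alpha> z = cis (2 * pi * \<alpha>) * z"

definition is_rotation :: "(complex \<Rightarrow> complex) \<Rightarrow> bool" where
  "is_rotation f \<longleftrightarrow> (\<exists>\<alpha>. \<forall>z\<in>circle. f z = rotation \<alpha> z)"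

definition is_lift :: "(real \<Rightarrow> real) \<Rightarrow> (complex \<Rightarrow> complex) \<Rightarrow> bool" where
  "is_lift F f \<longleftrightarrow> continuous_on UNIV F \<and>
     (\<forall>t. cis (2 * pi * F t) = f (cis (2 * pi * t)))"

definition orientation_preserving :: "(complex \<Rightarrow> complex) \<Rightarrow> bool" where
  "orientation_preserving f \<longleftrightarrow> (\<exists>F. is_lift F f \<and> strict_mono F)"

text \<open>
  The rotation number is an element of the real line modulo 1; the following says that
  \<^term>\<open>\<rho>\<close> is one of its representatives.
\<close>

definition has_rotation_number :: "(complex \<Rightarrow> complex) \<Rightarrow> real \<Rightarrow> bool" where
  "has_rotation_number f \<rho> \<longleftrightarrow> (\<exists>F. is_lift F f \<and> strict_mono F \<and>
     (\<forall>t. (\<lambda>n. (F ^^ n) t / real n) \<longlonglongrightarrow> \<rho>))"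

definition semiconjugate_on ::
    "'a::topological_space set \<Rightarrow> ('a \<Rightarrow> 'a) \<Rightarrow> ('a \<Rightarrow> 'a) \<Rightarrow> bool" where
  "semiconjugate_on M f g \<longleftrightarrow>
     (\<exists>h. continuous_on M h \<and> h ` M = M \<and> (\<forall>x\<in>M. h (f x) = g (h x)))"

definition conjugate_on ::
    "'a::topological_space set \<Rightarrow> ('a \<Rightarrow> 'a) \<Rightarrow> ('a \<Rightarrow> 'a) \<Rightarrow> bool" where
  "conjugate_on M f g \<longleftrightarrow>
     (\<exists>h k. homeomorphism M M h k \<and> (\<forall>x\<in>M. h (f x) = g (h x)))"

definition denjoy_map :: "(complex \<Rightarrow> complex) \<Rightarrow> bool" where
  "denjoy_map f \<longleftrightarrow> circle_homeo f \<and> orientation_preserving f \<and>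
     (\<exists>\<rho>. has_rotation_number f \<rho> \<and> \<rho> \<notin> \<rat> \<and>
        semiconjugate_on circle f (rotation \<rho>) \<and> \<not> conjugate_on circle f (rotation \<rho>))"

text \<open>
  The tangent line of the circle at \<^term>\<open>p\<close> is spanned by \<^term>\<open>\<i> * p\<close>, the velocity at time 0
  of \<^term>\<open>\<lambda>t. p * cis t\<close>. So, for a fixed point \<^term>\<open>p\<close> of the iterate of order \<^term>\<open>q\<close>, the
  real number \<^term>\<open>l\<close> below is the derivative of that iterate at \<^term>\<open>p\<close>, as a map of the circle.
\<close>

definition hyperbolic_periodic :: "(complex \<Rightarrow> complex) \<Rightarrow> complex \<Rightarrow> bool" where
  "hyperbolic_periodic f p \<longleftrightarrow> p \<in> circle \<and>
     (\<exists>q\<ge>1. (f ^^ q) p = p \<and>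
       (\<exists>l::real. \<bar>l\<bar> \<noteq> 1 \<and>
         ((\<lambda>t. (f ^^ q) (p * cis t)) has_vector_derivative (of_real l * (\<i> * p))) (at 0)))"

definition morse_smale :: "(complex \<Rightarrow> complex) \<Rightarrow> bool" where
  "morse_smale f \<longleftrightarrow> circle_homeo f \<and> finite (nonwandering circle f) \<and>
     (\<forall>p\<in>nonwandering circle f. hyperbolic_periodic f p)"

end

theory Submission
  imports Defs
begin

text \<open>
  The order of a circle homeomorphism never exceeds \<open>[n]\<close>. Cut the circle into short arcs by finitely
  many points; the preimages of these cut points under the iterates up to time \<open>n\<close> are linearly many,
  and a whole arc between neighbouring preimages stays short up to time \<open>n\<close>
  (\<open>linear_spanning_sets\<close>). So the question is only when the order drops to \<open>0\<close>, and two general facts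
  decide it. Under Lyapunov stability, a single cover by small balls serves all times, which gives
  order \<open>0\<close> (\<open>lyapunov_stable_imp_gen_entropy_zero\<close>). A wandering point, on the other hand, has a
  backward orbit whose first \<open>n + 1\<close> points are separated at time \<open>n\<close>, which gives order \<open>[n]\<close>
  (\<open>gen_entropy_linear_of_wandering\<close>). In particular a map with a wandering point is not Lyapunov
  stable.

  If there is a periodic point, an even iterate lifts to an increasing map of the line with fixed
  points. Orbits of an increasing map between two fixed points are monotone and converge, so every
  point moved by that iterate is attracted, together with a neighbourhood, to a periodic point, and
  is therefore wandering. Hence one iterate is the identity on the nonwandering set
  (\<open>nonwandering_imp_common_period\<close>), the order there is \<open>0\<close>, and the order on the circle is \<open>0\<close> or \<open>[n]\<close>
  according to whether wandering points exist.

  If there is no periodic point, the lift \<open>F\<close> is increasing and its rotation number \<open>\<rho>\<close> is irrational.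
  The function \<open>H t = limsup (F\<^sup>n t - n \<rho>)\<close> is nondecreasing, commutes with integer translations and
  satisfies \<open>H (F t) = H t + \<rho>\<close>. Its range contains a dense set \<open>H t + n \<rho> + m\<close>, so \<open>H\<close> is continuous: it
  is Poincare's semiconjugacy to the rotation. If \<open>H\<close> is injective it is a conjugacy, and \<open>f\<close> is Lyapunov
  stable with all points nonwandering. Otherwise \<open>H\<close> collapses an interval \<open>[a, b]\<close>. The left ends of
  the intervals \<open>F\<^sup>-\<^sup>j [a, b]\<close> are nonwandering, because \<open>H\<close> increases strictly to the left of
  them. Any arc between two of these left ends contains one of the intervals, which grows to the size
  of \<open>[a, b]\<close> in at most \<open>n\<close> steps. So these points are separated, and already the nonwandering set
  has order \<open>[n]\<close> (\<open>gen_entropy_of_not_inj\<close>).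

  For the comparison, a Denjoy map has this second kind of \<open>H\<close>, since injectivity of \<open>H\<close> would conjugate it
  to the rotation. A Morse--Smale map has a finite nonwandering set: the order on that set
  is not linear, and wandering points exist, so it has entropy numbers \<open>(0, [n])\<close>. A rotation is an
  isometry, hence Lyapunov stable.
\<close>

section \<open>Spanning and separated families\<close>

lemma bowen_dist_le_iff:
  "bowen_dist f n x y \<le> e \<longleftrightarrow> (\<forall>i\<le>n. dist ((f ^^ i) x) ((f ^^ i) y) \<le> e)"
  unfolding bowen_dist_def by (subst Max_le_iff) auto

lemma dist_iterate_le_bowen_dist: "i \<le> n \<Longrightarrow> dist ((f ^^ i) x) ((f ^^ i) y) \<le> bowen_dist f n x y"
  using bowen_dist_le_iff[of f n x y "bowen_dist f n x y"] by simp

lemma bowen_dist_commute: "bowen_dist f n x y = bowen_dist f n y x"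
  by (simp add: bowen_dist_def dist_commute)

lemma bowen_dist_triangle_left:
  "bowen_dist f n x y \<le> bowen_dist f n z x + bowen_dist f n z y"
  unfolding bowen_dist_le_iff
proof (intro allI impI)
  fix i assume "i \<le> n"
  have "dist ((f ^^ i) x) ((f ^^ i) y)
      \<le> dist ((f ^^ i) z) ((f ^^ i) x) + dist ((f ^^ i) z) ((f ^^ i) y)"
    by (rule dist_triangle3)
  also have "\<dots> \<le> bowen_dist f n z x + bowen_dist f n z y"
    using \<open>i \<le> n\<close> by (intro add_mono dist_iterate_le_bowen_dist)
  finally show "dist ((f ^^ i) x) ((f ^^ i) y) \<le> bowen_dist f n z x + bowen_dist f n z y" .
qed

definition spanning_set :: "'a::metric_space set \<Rightarrow> ('a \<Rightarrow> 'a) \<Rightarrow> real \<Rightarrow> nat \<Rightarrow> 'a set \<Rightarrow> bool" where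
  "spanning_set M f \<epsilon> n E \<longleftrightarrow> finite E \<and> E \<subseteq> M \<and> M = (\<Union>x\<in>E. bowen_ball M f x n \<epsilon>)"

lemma spanning_set_iff:
  "spanning_set M f \<epsilon> n E \<longleftrightarrow>
     finite E \<and> E \<subseteq> M \<and> (\<forall>y\<in>M. \<exists>x\<in>E. bowen_dist f n x y \<le> \<epsilon>)"
  unfolding spanning_set_def bowen_ball_def by auto

lemma spanning_number_eq_Least:
  "spanning_number M f \<epsilon> n = (LEAST k. \<exists>E. spanning_set M f \<epsilon> n E \<and> card E = k)"
  unfolding spanning_number_def spanning_set_def by (simp add: conj_ac)

lemma spanning_number_le_card: "spanning_set M f \<epsilon> n E \<Longrightarrow> spanning_number M f \<epsilon> n \<le> card E"
  unfolding spanning_number_eq_Least by (rule Least_le) auto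

lemma spanning_number_attained:
  assumes "spanning_set M f \<epsilon> n E"
  obtains E' where "spanning_set M f \<epsilon> n E'" "card E' = spanning_number M f \<epsilon> n"
proof -
  have "\<exists>k E'. spanning_set M f \<epsilon> n E' \<and> card E' = k" using assms by auto
  then have "\<exists>E'. spanning_set M f \<epsilon> n E' \<and> card E' = spanning_number M f \<epsilon> n"
    unfolding spanning_number_eq_Least by (rule LeastI_ex)
  with that show thesis by blast
qed

text \<open>
  Spanning sets must consist of points of \<open>M\<close>. Stating covers through pieces of small Bowen diameter,
  rather than through balls, makes the same cover of the circle usable for each of its subsets: pick a
  point of \<open>M\<close> in each piece that meets \<open>M\<close>.
\<close>

lemma spanning_set_of_cover:
  assumes "finite \<P>" "M \<subseteq> \<Union>\<P>"
    and small: "\<And>P x y. P \<in> \<P> \<Longrightarrow> x \<in> P \<inter> M \<Longrightarrow> y \<in> P \<inter> M \<Longrightarrow> bowen_dist f n x y \<le> \<epsilon>"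
  obtains E where "spanning_set M f \<epsilon> n E" "card E \<le> card \<P>"
proof -
  define \<Q> where "\<Q> = {P \<in> \<P>. P \<inter> M \<noteq> {}}"
  have "\<forall>P\<in>\<Q>. \<exists>x. x \<in> P \<inter> M" by (auto simp: \<Q>_def)
  then obtain c where pick: "\<And>P. P \<in> \<Q> \<Longrightarrow> c P \<in> P \<inter> M" by metis
  define E where "E = c ` \<Q>"
  have fin: "finite \<Q>" and sub: "\<Q> \<subseteq> \<P>" using assms(1) by (auto simp: \<Q>_def)
  have "\<exists>x\<in>E. bowen_dist f n x y \<le> \<epsilon>" if "y \<in> M" for y
  proof -
    obtain P where P: "P \<in> \<P>" "y \<in> P" using \<open>y \<in> M\<close> assms(2) by blast
    then have "P \<in> \<Q>" using that by (auto simp: \<Q>_def)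
    then show ?thesis
      unfolding E_def using small[OF P(1) pick] P(2) that by auto
  qed
  moreover have "finite E" "E \<subseteq> M" using fin pick unfolding E_def by blast+
  ultimately have "spanning_set M f \<epsilon> n E" unfolding spanning_set_iff by blast
  moreover have "card E \<le> card \<P>"
  proof -
    have "card E \<le> card \<Q>" unfolding E_def using fin by (rule card_image_le)
    also have "\<dots> \<le> card \<P>" using assms(1) sub by (rule card_mono)
    finally show ?thesis .
  qed
  ultimately show thesis by (rule that)
qed

text \<open>
  A Bowen ball of radius \<open>\<epsilon>\<close> contains at most one point of a family separated by more than \<open>2 \<epsilon>\<close>. The
  existence of a spanning set is assumed because the spanning number is a least natural number, which
  carries no information if there is no finite spanning set.
\<close>

lemma card_separated_le_spanning_number:
  assumes span: "spanning_set M f \<epsilon> n E"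
    and p: "\<And>i. i \<in> I \<Longrightarrow> p i \<in> M"
    and sep: "\<And>i j. i \<in> I \<Longrightarrow> j \<in> I \<Longrightarrow> i \<noteq> j \<Longrightarrow> 2 * \<epsilon> < bowen_dist f n (p i) (p j)"
  shows "card I \<le> spanning_number M f \<epsilon> n"
proof -
  obtain E where E: "spanning_set M f \<epsilon> n E" "card E = spanning_number M f \<epsilon> n"
    using spanning_number_attained[OF span] .
  have "\<forall>i\<in>I. \<exists>x\<in>E. bowen_dist f n x (p i) \<le> \<epsilon>"
    using E(1) p by (auto simp: spanning_set_iff)
  then obtain c where c: "\<And>i. i \<in> I \<Longrightarrow> c i \<in> E \<and> bowen_dist f n (c i) (p i) \<le> \<epsilon>"
    by metis
  have "inj_on c I"
  proof (rule inj_onI, rule ccontr)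
    fix i j assume ij: "i \<in> I" "j \<in> I" "c i = c j" "i \<noteq> j"
    have "bowen_dist f n (p i) (p j) \<le> bowen_dist f n (c i) (p i) + bowen_dist f n (c i) (p j)"
      by (rule bowen_dist_triangle_left)
    also have "\<dots> \<le> 2 * \<epsilon>" using c[OF ij(1)] c[OF ij(2)] ij(3) by simp
    finally show False using sep[OF ij(1,2,4)] by simp
  qed
  then have "card I \<le> card E"
    using c E(1) by (intro card_inj_on_le) (auto simp: spanning_set_iff)
  then show ?thesis using E(2) by simp
qed

lemma spanning_number_mono:
  assumes "spanning_set M f \<epsilon> n E" "m \<le> n"
  shows "spanning_number M f \<epsilon> m \<le> spanning_number M f \<epsilon> n"
proof -
  obtain E where E: "spanning_set M f \<epsilon> n E" "card E = spanning_number M f \<epsilon> n"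
    using spanning_number_attained[OF assms(1)] .
  have "spanning_set M f \<epsilon> m E"
    using E(1) assms(2) unfolding spanning_set_iff bowen_dist_le_iff by (meson order.trans)
  then show ?thesis using spanning_number_le_card E(2) by metis
qed

lemma one_le_spanning_number:
  assumes "spanning_set M f \<epsilon> n E" "M \<noteq> {}"
  shows "1 \<le> spanning_number M f \<epsilon> n"
proof -
  obtain x where "x \<in> M" using assms(2) by auto
  with card_separated_le_spanning_number[OF assms(1), of "{0::nat}" "\<lambda>_. x"] show ?thesis by simp
qed

lemma spanning_number_growth:
  assumes "\<And>n. \<exists>E. spanning_set M f \<epsilon> n E"
  shows "(\<lambda>n. real (spanning_number M f \<epsilon> n)) \<in> growth_seqs"
  using assms spanning_number_mono by (fastforce simp: growth_seqs_def mono_on_def)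


section \<open>Constant and linear order\<close>

lemma linear_growth: "(\<lambda>n. real n) \<in> growth_seqs"
  by (auto simp: growth_seqs_def mono_on_def)

lemma one_growth: "(\<lambda>_. 1::real) \<in> growth_seqs"
  by (rule const_in_growth_seqs) simp

lemma order_zero_neq_order_linear: "order_zero \<noteq> order_linear"
proof
  assume "order_zero = order_linear"
  then have "growth_le (\<lambda>n. real n) (\<lambda>_. 1)"
    unfolding order_zero_def order_linear_def dm_embed_eq_iff
    using growth_class_le_iff[OF linear_growth one_growth] by simp
  then obtain C where C: "\<And>n. n \<ge> 1 \<Longrightarrow> real n \<le> C" by (auto simp: growth_le_def)
  obtain n :: nat where "C < real n" using reals_Archimedean2 by blast
  then show False using C[of "Suc n"] by simp
qed

lemma order_zero_less_order_linear: "order_zero < order_linear"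
proof -
  have "growth_le (\<lambda>_. 1) (\<lambda>n. real n)"
    unfolding growth_le_def by (rule exI[of _ 1]) auto
  then have "order_zero \<le> order_linear"
    unfolding order_zero_def order_linear_def dm_embed_le_iff
    using growth_class_le_iff[OF one_growth linear_growth] by simp
  then show ?thesis using order_zero_neq_order_linear by simp
qed

lemma gen_entropy_eq_zeroI:
  assumes "M \<noteq> {}"
    and bound: "\<And>\<epsilon>. \<epsilon> > 0 \<Longrightarrow> \<exists>K. \<forall>n. \<exists>E. spanning_set M f \<epsilon> n E \<and> card E \<le> K"
  shows "gen_entropy M f = order_zero"
proof -
  have "order_of (\<lambda>n. real (spanning_number M f \<epsilon> n)) = order_zero" if "\<epsilon> > 0" for \<epsilon>
  proof -
    obtain K where K: "\<And>n. \<exists>E. spanning_set M f \<epsilon> n E \<and> card E \<le> K"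
      using bound[OF \<open>\<epsilon> > 0\<close>] by blast
    then have ex: "\<And>n. \<exists>E. spanning_set M f \<epsilon> n E" by blast
    have le: "spanning_number M f \<epsilon> n \<le> K" for n
      using K spanning_number_le_card order_trans by metis
    have ge: "1 \<le> spanning_number M f \<epsilon> n" for n
      using one_le_spanning_number ex assms(1) by metis
    have g: "(\<lambda>n. real (spanning_number M f \<epsilon> n)) \<in> growth_seqs"
      using ex by (rule spanning_number_growth)
    have "growth_le (\<lambda>n. real (spanning_number M f \<epsilon> n)) (\<lambda>_. 1)"
      unfolding growth_le_def using le order_trans[OF ge[of 0] le[of 0]]
      by (intro exI[of _ "real K"]) auto
    moreover have "growth_le (\<lambda>_. 1) (\<lambda>n. real (spanning_number M f \<epsilon> n))"
      unfolding growth_le_def using ge by (intro exI[of _ 1]) simp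
    ultimately show ?thesis
      unfolding order_zero_def dm_embed_eq_iff
      by (intro antisym) (simp_all add: growth_class_le_iff g one_growth)
  qed
  then have "{order_of (\<lambda>n. real (spanning_number M f \<epsilon> n)) | \<epsilon>. \<epsilon> > 0} = {order_zero}"
    by (auto intro!: exI[of _ "1::real"])
  then show ?thesis unfolding gen_entropy_def by simp
qed

text \<open>
  A single scale \<open>\<delta>\<close> with linearly many balls suffices for the lower bound, as the order is a supremum
  over all scales.
\<close>

lemma gen_entropy_eq_linearI:
  assumes upper: "\<And>\<epsilon>. \<epsilon> > 0 \<Longrightarrow> \<exists>K. \<forall>n. \<exists>E. spanning_set M f \<epsilon> n E \<and> card E \<le> K * (n + 1)"
    and "\<delta> > 0" and lower: "\<And>n. n \<le> spanning_number M f \<delta> n"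
  shows "gen_entropy M f = order_linear"
  unfolding gen_entropy_def
proof (rule antisym)
  have g: "(\<lambda>n. real (spanning_number M f \<epsilon> n)) \<in> growth_seqs" if "\<epsilon> > 0" for \<epsilon>
    using upper[OF that] by (intro spanning_number_growth) blast
  show "Sup {order_of (\<lambda>n. real (spanning_number M f \<epsilon> n)) | \<epsilon>. \<epsilon> > 0} \<le> order_linear"
  proof (rule Sup_least, clarify)
    fix \<epsilon> :: real assume "\<epsilon> > 0"
    then obtain K where K: "\<And>n. \<exists>E. spanning_set M f \<epsilon> n E \<and> card E \<le> K * (n + 1)"
      using upper by blast
    have "real (spanning_number M f \<epsilon> n) \<le> (2 * real K + 1) * real n" if "n \<ge> 1" for n
    proof -
      have "spanning_number M f \<epsilon> n \<le> K * (n + 1)"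
        using K spanning_number_le_card order_trans by metis
      also have "\<dots> \<le> K * (2 * n) + n" using that by (intro trans_le_add1 mult_le_mono) auto
      finally have "real (spanning_number M f \<epsilon> n) \<le> real (K * (2 * n) + n)"
        by (rule of_nat_mono)
      then show ?thesis by (simp add: algebra_simps)
    qed
    then have "growth_le (\<lambda>n. real (spanning_number M f \<epsilon> n)) (\<lambda>n. real n)"
      unfolding growth_le_def by (intro exI[of _ "2 * real K + 1"]) auto
    then show "order_of (\<lambda>n. real (spanning_number M f \<epsilon> n)) \<le> order_linear"
      unfolding order_linear_def dm_embed_le_iff
      by (simp add: growth_class_le_iff g[OF \<open>\<epsilon> > 0\<close>] linear_growth)
  qed
  have "growth_le (\<lambda>n. real n) (\<lambda>n. real (spanning_number M f \<delta> n))"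
    unfolding growth_le_def using lower by (intro exI[of _ 1]) auto
  then have "order_linear \<le> order_of (\<lambda>n. real (spanning_number M f \<delta> n))"
    unfolding order_linear_def dm_embed_le_iff
    by (simp add: growth_class_le_iff g[OF \<open>\<delta> > 0\<close>] linear_growth)
  also have "\<dots> \<le> Sup {order_of (\<lambda>n. real (spanning_number M f \<epsilon> n)) | \<epsilon>. \<epsilon> > 0}"
    using \<open>\<delta> > 0\<close> by (intro Sup_upper) auto
  finally show "order_linear \<le> Sup {order_of (\<lambda>n. real (spanning_number M f \<epsilon> n)) | \<epsilon>. \<epsilon> > 0}" .
qed

text \<open>
  Points that start close stay close for ever, so a cover by small balls has small Bowen diameter at
  all times at once.
\<close>

lemma lyapunov_stable_imp_gen_entropy_zero:
  assumes "compact K" "M \<subseteq> K" "M \<noteq> {}" "lyapunov_stable M f"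
  shows "gen_entropy M f = order_zero"
proof (rule gen_entropy_eq_zeroI[OF \<open>M \<noteq> {}\<close>])
  fix \<epsilon> :: real assume "\<epsilon> > 0"
  then obtain \<delta> where \<delta>: "\<delta> > 0"
    and stable: "\<And>x y n. \<lbrakk>x \<in> M; y \<in> M; dist x y < \<delta>; n \<ge> 1\<rbrakk> \<Longrightarrow> dist ((f ^^ n) x) ((f ^^ n) y) < \<epsilon>"
    using assms(4) unfolding lyapunov_stable_def by metis
  define r where "r = min \<delta> \<epsilon> / 2"
  have "r > 0" using \<delta> \<open>\<epsilon> > 0\<close> by (simp add: r_def)
  then obtain C where C: "finite C" "K \<subseteq> (\<Union>x\<in>C. ball x r)"
    using seq_compact_imp_totally_bounded[of K] assms(1) by (meson compact_imp_seq_compact)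
  have "\<exists>E. spanning_set M f \<epsilon> n E \<and> card E \<le> card C" for n
  proof -
    have "bowen_dist f n x y \<le> \<epsilon>" if "P \<in> (\<lambda>c. ball c r) ` C" "x \<in> P \<inter> M" "y \<in> P \<inter> M" for P x y
    proof -
      have d: "dist x y < 2 * r"
        using that by (auto intro: dist_triangle_less_add)
          (smt (verit) dist_commute dist_triangle3)
      have "dist ((f ^^ i) x) ((f ^^ i) y) \<le> \<epsilon>" for i
        using stable[of x y i] that d by (cases i) (auto simp: r_def)
      then show ?thesis by (simp add: bowen_dist_le_iff)
    qed
    moreover have "finite ((\<lambda>c. ball c r) ` C)" "M \<subseteq> \<Union>((\<lambda>c. ball c r) ` C)"
      using C assms(2) by auto
    ultimately obtain E where "spanning_set M f \<epsilon> n E" "card E \<le> card ((\<lambda>c. ball c r) ` C)"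
      using spanning_set_of_cover[of "(\<lambda>c. ball c r) ` C" M f n \<epsilon>] by blast
    then show ?thesis using card_image_le[OF C(1)] order_trans by metis
  qed
  then show "\<exists>k. \<forall>n. \<exists>E. spanning_set M f \<epsilon> n E \<and> card E \<le> k" by blast
qed

lemma funpow_mod_of_period: "(f ^^ q) x = x \<Longrightarrow> (f ^^ n) x = (f ^^ (n mod q)) x"
  using funpow_mod_eq[where f = f and n = q and m = n and x = x] by simp

text \<open>
  With a common period only finitely many iterates occur on \<open>M\<close>, and finitely many uniformly continuous
  maps share a modulus of continuity.
\<close>

lemma lyapunov_stable_of_period:
  assumes "q \<ge> 1" "\<And>x. x \<in> M \<Longrightarrow> (f ^^ q) x = x"
    and unif: "\<And>i. uniformly_continuous_on M (f ^^ i)"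
  shows "lyapunov_stable M f"
  unfolding lyapunov_stable_def
proof (intro allI impI)
  fix \<epsilon> :: real assume "\<epsilon> > 0"
  then have "\<forall>i. \<exists>\<delta>>0. \<forall>x\<in>M. \<forall>y\<in>M. dist x y < \<delta> \<longrightarrow> dist ((f ^^ i) x) ((f ^^ i) y) < \<epsilon>"
    using unif unfolding uniformly_continuous_on_def by (metis dist_commute)
  then obtain \<delta> where \<delta>: "\<And>i. \<delta> i > 0"
    "\<And>i x y. \<lbrakk>x \<in> M; y \<in> M; dist x y < \<delta> i\<rbrakk> \<Longrightarrow> dist ((f ^^ i) x) ((f ^^ i) y) < \<epsilon>"
    by metis
  define d where "d = Min (\<delta> ` {..<q})"
  have "0 \<in> {..<q}" using assms(1) by simp
  then have ne: "\<delta> ` {..<q} \<noteq> {}" by blast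
  then have d0: "d > 0" using \<delta>(1) by (simp add: d_def)
  have "dist ((f ^^ n) x) ((f ^^ n) y) < \<epsilon>" if "x \<in> M" "y \<in> M" "dist x y < d" for x y n
  proof -
    have "n mod q < q" using assms(1) by simp
    then have "d \<le> \<delta> (n mod q)" unfolding d_def by (intro Min_le) auto
    with that have "dist ((f ^^ (n mod q)) x) ((f ^^ (n mod q)) y) < \<epsilon>" by (intro \<delta>(2)) auto
    then show ?thesis
      using funpow_mod_of_period[OF assms(2)[OF that(1)], of n]
        funpow_mod_of_period[OF assms(2)[OF that(2)], of n] by simp
  qed
  with d0 show "\<exists>\<delta>>0. \<forall>x\<in>M. \<forall>y\<in>M. dist x y < \<delta> \<longrightarrow> (\<forall>n\<ge>1. dist ((f ^^ n) x) ((f ^^ n) y) < \<epsilon>)"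
    by blast
qed

section \<open>The circle as a quotient of the line\<close>

abbreviation turn :: "real \<Rightarrow> complex" where
  "turn t \<equiv> cis (2 * pi * t)"

lemma turn_in_circle: "turn t \<in> circle"
  by simp

lemma turn_add: "turn (s + t) = turn s * turn t"
  by (simp add: cis_mult ring_distribs)

lemma turn_eq_iff: "turn s = turn t \<longleftrightarrow> s - t \<in> \<int>"
proof
  assume "s - t \<in> \<int>"
  then have "turn (s - t) = 1" by (rule cis_multiple_2pi)
  with turn_add[of "s - t" t] show "turn s = turn t" by simp
next
  assume "turn s = turn t"
  then have "sin (2 * pi * s) = sin (2 * pi * t) \<and> cos (2 * pi * s) = cos (2 * pi * t)"
    by (simp add: complex_eq_iff)
  then obtain n :: int where n: "2 * pi * s = 2 * pi * t + 2 * pi * of_int n"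
    using sin_cos_eq_iff by blast
  then have "2 * pi * (s - t - of_int n) = 0" by (simp add: algebra_simps)
  then have "s - t = of_int n" by simp
  then show "s - t \<in> \<int>" by simp
qed

lemma turn_add_int: "turn (t + of_int m) = turn t"
  by (simp add: turn_eq_iff)

lemma circle_eq_range_turn: "circle = range turn"
proof
  show "circle \<subseteq> range turn"
  proof
    fix z :: complex assume "z \<in> circle"
    then have "z = cis (Arg z)" using cis_Arg[of z] by (cases "z = 0") (auto simp: sgn_eq)
    also have "\<dots> = turn (Arg z / (2 * pi))" by simp
    finally show "z \<in> range turn" by blast
  qed
qed auto

lemma circle_turnE:
  assumes "z \<in> circle"
  obtains t where "z = turn t" "0 \<le> t" "t < 1"
proof -
  obtain s where "z = turn s" using assms circle_eq_range_turn by auto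
  moreover have "turn (frac s) = turn s" by (simp add: turn_eq_iff frac_def)
  ultimately show thesis using that[of "frac s"] frac_ge_0[of s] frac_lt_1[of s] by metis
qed

lemma continuous_on_turn: "continuous_on S turn"
  by (intro continuous_intros)

lemma dist_turn: "dist (turn s) (turn t) = 2 * \<bar>sin (pi * (s - t))\<bar>"
proof -
  have "dist (turn s) (turn t) = norm (turn t * (turn (s - t) - 1))"
    using turn_add[of t "s - t"] by (simp add: dist_norm algebra_simps)
  also have "\<dots> = norm (exp (\<i> * of_real (2 * pi * (s - t))) - 1)"
    by (simp add: norm_mult cis_conv_exp)
  also have "\<dots> = 2 * \<bar>sin (pi * (s - t))\<bar>"
    by (subst dist_exp_i_1) simp
  finally show ?thesis .
qed

lemma dist_turn_le: "dist (turn s) (turn t) \<le> 2 * pi * \<bar>s - t\<bar>"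
  unfolding dist_turn using abs_sin_le_one abs_sin_x_le_abs_x[of "pi * (s - t)"]
  by (simp add: abs_mult)

text \<open>
  Distances on the circle control distances on the line only up to half a turn; this is why lifted
  points are always compared at distance at most \<open>1 / 2\<close> below.
\<close>

lemma dist_turn_ge:
  assumes "0 \<le> \<eta>" "\<eta> \<le> t - s" "t - s \<le> 1 / 2"
  shows "2 * sin (pi * \<eta>) \<le> dist (turn s) (turn t)"
proof -
  have "sin (pi * \<eta>) \<le> sin (pi * (t - s))"
  proof (rule sin_monotone_2pi_le)
    have "pi * (t - s) \<le> pi * (1 / 2)" using assms(3) by (intro mult_left_mono) auto
    then show "pi * (t - s) \<le> pi / 2" by simp
    show "pi * \<eta> \<le> pi * (t - s)" using assms(2) by (intro mult_left_mono) auto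
    have "0 \<le> pi * \<eta>" using assms(1) by simp
    then show "- (pi / 2) \<le> pi * \<eta>" using pi_gt_zero by linarith
  qed
  then show ?thesis
    unfolding dist_commute[of "turn s"] dist_turn[of t s] by linarith
qed

lemma open_turn_vimage:
  assumes "openin (top_of_set circle) U" "turn x \<in> U"
  obtains \<eta> where "\<eta> > 0" "\<And>t. \<bar>t - x\<bar> < \<eta> \<Longrightarrow> turn t \<in> U"
proof -
  obtain T where T: "open T" "U = circle \<inter> T" using assms(1) by (auto simp: openin_open)
  then have "open (turn -` T)" by (intro open_vimage continuous_on_turn)
  moreover have "x \<in> turn -` T" using T assms(2) by auto
  ultimately obtain \<eta> where "\<eta> > 0" "ball x \<eta> \<subseteq> turn -` T"
    by (meson open_contains_ball)
  then show thesis
    using that[of \<eta>] T(2) by (auto simp: subset_iff dist_real_def abs_minus_commute)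
qed

lemma circle_homeoD:
  assumes "circle_homeo f"
  shows "continuous_on circle f" "f ` circle = circle" "inj_on f circle"
proof -
  obtain g where "homeomorphism circle circle f g" using assms unfolding circle_homeo_def by blast
  then show "continuous_on circle f" "f ` circle = circle" "inj_on f circle"
    by (auto simp: homeomorphism_def intro: inj_on_inverseI)
qed

lemma funpow_circle:
  assumes "circle_homeo f"
  shows "(f ^^ n) ` circle = circle" "continuous_on circle (f ^^ n)"
proof (induction n)
  case (Suc n)
  { case 1 show ?case
      using Suc(1) circle_homeoD(2)[OF assms] by (simp only: funpow.simps image_comp[symmetric])
  next
    case 2 show ?case
      using continuous_on_compose[OF Suc(2), of f] Suc(1) circle_homeoD(1)[OF assms]
      by (simp add: comp_def) }
qed (auto simp: continuous_on_id)

lemma funpow_in_circle: "circle_homeo f \<Longrightarrow> x \<in> circle \<Longrightarrow> (f ^^ n) x \<in> circle"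
  using funpow_circle(1) by blast

lemma uniformly_continuous_funpow:
  assumes "circle_homeo f" "M \<subseteq> circle"
  shows "uniformly_continuous_on M (f ^^ n)"
proof -
  have "compact circle" by simp
  then have "uniformly_continuous_on circle (f ^^ n)"
    using funpow_circle(2)[OF assms(1)] by (intro compact_uniformly_continuous)
  then show ?thesis using assms(2) unfolding uniformly_continuous_on_def by (meson subsetD)
qed

lemma nonwandering_subset: "nonwandering M f \<subseteq> M"
  by (auto simp: nonwandering_def)


section \<open>Lifts of circle homeomorphisms\<close>

text \<open>
  The line is contractible, so the nonvanishing function \<open>f \<circ> turn\<close> has a continuous logarithm.
\<close>

lemma lift_exists:
  assumes "circle_homeo f"
  obtains F where "is_lift F f"
proof -
  have circ: "f (turn t) \<in> circle" for t
    using circle_homeoD(2)[OF assms] turn_in_circle by blast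
  have "continuous_on UNIV (\<lambda>t. f (turn t))"
    by (rule continuous_on_compose2[OF circle_homeoD(1)[OF assms] continuous_on_turn]) auto
  moreover have "f (turn t) \<noteq> 0" for t using circ[of t] by auto
  ultimately obtain g where g: "continuous_on UNIV g" "\<And>t. f (turn t) = exp (g t)"
    using continuous_logarithm_on_contractible[of UNIV "\<lambda>t. f (turn t)"] by auto
  have "turn (Im (g t) / (2 * pi)) = f (turn t)" for t
  proof -
    have "norm (exp (g t)) = 1" using circ[of t] g(2) by simp
    then have "Re (g t) = 0" by (rule norm_exp_imaginary)
    then show ?thesis using g(2)[of t] by (simp add: exp_eq_polar)
  qed
  moreover have "continuous_on UNIV (\<lambda>t. Im (g t) / (2 * pi))"
    using g(1) by (intro continuous_intros) auto
  ultimately have "is_lift (\<lambda>t. Im (g t) / (2 * pi)) f" by (auto simp: is_lift_def)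
  then show thesis by (rule that)
qed

lemma continuous_integer_valued_constant:
  fixes g :: "real \<Rightarrow> real"
  assumes "continuous_on UNIV g" "\<And>t. g t \<in> \<int>"
  obtains k :: int where "\<And>t. g t = of_int k"
proof -
  have "g constant_on UNIV"
  proof (rule continuous_discrete_range_constant)
    show "\<exists>e>0. \<forall>y. y \<in> UNIV \<and> g y \<noteq> g x \<longrightarrow> e \<le> norm (g y - g x)" for x
    proof (intro exI[of _ 1] conjI allI impI)
      fix y assume "y \<in> UNIV \<and> g y \<noteq> g x"
      then show "1 \<le> norm (g y - g x)"
        using assms(2)[of x] assms(2)[of y] Ints_nonzero_abs_ge1[of "g y - g x"] by simp
    qed simp
  qed (use assms in auto)
  moreover obtain k where "g 0 = of_int k" using assms(2) by (auto elim: Ints_cases)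
  ultimately show thesis using that[of k] unfolding constant_on_def by (metis UNIV_I)
qed

locale circle_lift =
  fixes f :: "complex \<Rightarrow> complex" and F :: "real \<Rightarrow> real"
  assumes homeo: "circle_homeo f" and lift: "is_lift F f"
begin

lemma cont: "continuous_on S F"
  using lift continuous_on_subset[of UNIV F S] by (simp add: is_lift_def)

lemma turn_lift: "turn (F t) = f (turn t)"
  using lift by (simp add: is_lift_def)

lemma turn_lift_funpow: "turn ((F ^^ n) t) = (f ^^ n) (turn t)"
  by (induction n) (simp_all add: turn_lift)

lemma diff_int_iff: "F s - F t \<in> \<int> \<longleftrightarrow> s - t \<in> \<int>"
  using inj_on_eq_iff[OF circle_homeoD(3)[OF homeo] turn_in_circle turn_in_circle, of s t]
  unfolding turn_eq_iff[symmetric] turn_lift .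

lemma nonint_of_small: "0 < s - t \<Longrightarrow> s - t < 1 \<Longrightarrow> F s - F t \<notin> \<int>"
  unfolding diff_int_iff by (auto elim!: Ints_cases)

lemma degree_exists:
  obtains d :: int where "\<And>t. F (t + 1) = F t + of_int d"
proof -
  have "continuous_on UNIV (\<lambda>t. F (t + 1) - F t)"
    by (intro continuous_intros continuous_on_compose2[OF cont[of UNIV]]) auto
  moreover have "F (t + 1) - F t \<in> \<int>" for t by (simp add: diff_int_iff)
  ultimately obtain d :: int where "\<And>t. F (t + 1) - F t = of_int d"
    using continuous_integer_valued_constant by blast
  then have "F (t + 1) = F t + of_int d" for t by (metis add.commute diff_add_cancel)
  then show thesis by (rule that)
qed

text \<open>
  If the degree vanished, \<open>F\<close> would take a value strictly between \<open>F 0\<close> and \<open>F (1/2)\<close> on both halves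
  of the unit interval, at two points less than a full turn apart.
\<close>

lemma degree_nonzero: "F 1 \<noteq> F 0"
proof
  assume eq: "F 1 = F 0"
  have ne: "F (1/2) \<noteq> F 0" using nonint_of_small[of "1/2" 0] by auto
  define v where "v = (F 0 + F (1/2)) / 2"
  obtain s where s: "0 \<le> s" "s \<le> 1/2" "F s = v"
  proof (cases "F 0 < F (1/2)")
    case True then show thesis using IVT'[of F 0 v "1/2"] that cont by (auto simp: v_def)
  next
    case False then show thesis using IVT2'[of F "1/2" v 0] that cont by (auto simp: v_def)
  qed
  obtain t where t: "1/2 \<le> t" "t \<le> 1" "F t = v"
  proof (cases "F 0 < F (1/2)")
    case True then show thesis using IVT2'[of F 1 v "1/2"] that cont eq by (auto simp: v_def)
  next
    case False then show thesis using IVT'[of F "1/2" v 1] that cont eq by (auto simp: v_def)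
  qed
  have "v \<noteq> F 0" "v \<noteq> F (1/2)" using ne by (auto simp: v_def)
  then have "s \<noteq> 0" "s \<noteq> 1/2" using s(3) by blast+
  then have "0 < t - s" "t - s < 1" using s t by auto
  from nonint_of_small[OF this] show False using s t by simp
qed

text \<open>
  If the degree exceeded \<open>1\<close> in absolute value, \<open>F\<close> would reach \<open>F 0 \<plusminus> 1\<close> strictly inside the unit
  interval, against injectivity on the circle.
\<close>

lemma degree_unit:
  assumes d: "\<And>t. F (t + 1) = F t + of_int d"
  shows "d = 1 \<or> d = - 1"
proof (rule ccontr)
  assume "\<not> ?thesis"
  moreover have "d \<noteq> 0" using degree_nonzero d[of 0] by auto
  ultimately have big: "2 \<le> \<bar>d\<bar>" by linarith
  have F1: "F 1 = F 0 + of_int d" using d[of 0] by simp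
  obtain t where t: "0 \<le> t" "t \<le> 1" "F t = F 0 + of_int (sgn d)"
  proof (cases "d > 0")
    case True
    then have "F 0 \<le> F 0 + 1" "F 0 + 1 \<le> F 1" using F1 big by auto
    then show thesis using IVT'[of F 0 "F 0 + 1" 1] cont that True by auto
  next
    case False
    then have "d \<le> -2" using big by linarith
    then have "F 1 \<le> F 0 - 1" "F 0 - 1 \<le> F 0" using F1 by auto
    then show thesis using IVT2'[of F 1 "F 0 - 1" 0] cont that \<open>d \<le> -2\<close> by auto
  qed
  have "F t - F 0 \<in> \<int>" using t(3) by simp
  then have "t \<in> \<int>" using diff_int_iff[of t 0] by simp
  with t(1,2) have "t = 0 \<or> t = 1" by (auto elim!: Ints_cases)
  moreover have "sgn d \<noteq> 0" "sgn d \<noteq> d" using big by (auto simp: sgn_if split: if_splits)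
  ultimately show False using t(3) F1 by auto
qed

lemma add_int_degree:
  assumes d: "\<And>t. F (t + 1) = F t + of_int d"
  shows "F (t + of_int m) = F t + of_int d * of_int m"
proof -
  have nat: "F (t + real n) = F t + of_int d * real n" for t n
  proof (induction n)
    case (Suc n)
    have "F (t + real (Suc n)) = F ((t + real n) + 1)" by (simp add: algebra_simps)
    then show ?case using Suc d[of "t + real n"] by (simp add: algebra_simps)
  qed simp
  show ?thesis
  proof (cases "m \<ge> 0")
    case True then show ?thesis using nat[of t "nat m"] by simp
  next
    case False
    then have "F t = F (t + of_int m) + of_int d * real_of_int (- m)"
      using nat[of "t + of_int m" "nat (- m)"] by simp
    then show ?thesis by simp
  qed
qed

text \<open>
  A continuous injective function on an interval is monotone, and the direction can be read off from the
  two ends of an interval of integer length.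
\<close>

lemma monotone:
  obtains d :: int where "d = 1 \<or> d = - 1" "\<And>t. F (t + 1) = F t + of_int d"
    "strict_mono (\<lambda>t. of_int d * F t)"
proof -
  obtain d :: int where d: "\<And>t. F (t + 1) = F t + of_int d" using degree_exists by blast
  have unit: "d = 1 \<or> d = - 1" using degree_unit d by blast
  have "inj F"
  proof (rule injI)
    fix s t assume "F s = F t"
    then have "s - t \<in> \<int>" using diff_int_iff[of s t] by simp
    then obtain m where m: "s - t = of_int m" by (auto elim: Ints_cases)
    then have "s = t + of_int m" by simp
    then have "F s = F t + of_int d * of_int m" using add_int_degree[of d t m] d by simp
    then have "of_int d * real_of_int m = 0" using \<open>F s = F t\<close> by simp
    then show "s = t" using unit m by auto
  qed
  have "strict_mono (\<lambda>t. of_int d * F t)"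
  proof (rule strict_monoI)
    fix s t :: real assume "s < t"
    obtain N :: nat where N: "t - s < real N" using reals_Archimedean2 by blast
    then have "N > 0" using \<open>s < t\<close> by (cases N) auto
    let ?G = "\<lambda>t. of_int d * F t"
    have "inj_on ?G {s..s + real N}"
      using unit injD[OF \<open>inj F\<close>] by (auto simp: inj_on_def)
    moreover have "continuous_on {s..s + real N} ?G" by (intro continuous_intros cont)
    ultimately have "(?G s < ?G t \<and> ?G t < ?G (s + real N)) \<or> (?G (s + real N) < ?G t \<and> ?G t < ?G s)"
      using \<open>s < t\<close> N by (intro continuous_inj_imp_mono) auto
    moreover have "?G (s + real N) = ?G s + real N"
      using add_int_degree[of d s "int N"] d unit by (auto simp: algebra_simps)
    ultimately show "?G s < ?G t" using \<open>N > 0\<close> by auto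
  qed
  with d unit show thesis by (intro that)
qed

end


section \<open>Linear bounds for the order of a circle homeomorphism\<close>

text \<open>
  The factor \<open>d ^ n\<close> turns the iterates of a lift of either orientation into increasing functions of
  degree one, so that both orientations can be treated together.
\<close>

lemma signed_funpow_strict_mono:
  fixes F :: "real \<Rightarrow> real"
  assumes "d = 1 \<or> d = (- 1 :: real)" and F: "strict_mono (\<lambda>t. d * F t)"
  shows "strict_mono (\<lambda>t. d ^ n * (F ^^ n) t)"
proof (induction n)
  case 0 show ?case by (simp add: strict_mono_def)
next
  case (Suc n)
  have "d ^ n = 1 \<or> d ^ n = - 1" using assms(1) by (cases "even n") auto
  then show ?case
  proof
    assume "d ^ n = 1"
    then show ?case using Suc F by (auto simp: strict_mono_def)
  next
    assume "d ^ n = -1"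
    then show ?case using Suc F by (auto simp: strict_mono_def)
  qed
qed

lemma signed_funpow_degree:
  fixes F :: "real \<Rightarrow> real"
  assumes "d = 1 \<or> d = (- 1 :: real)" and F: "\<And>t. F (t + 1) = F t + d"
  shows "d ^ n * (F ^^ n) (t + 1) = d ^ n * (F ^^ n) t + 1"
proof -
  have F': "F (t - 1) = F t - d" for t using F[of "t - 1"] by simp
  have "(F ^^ n) (t + 1) = (F ^^ n) t + d ^ n"
  proof (induction n)
    case (Suc n)
    have "d ^ n = 1 \<or> d ^ n = - 1" using assms(1) by (cases "even n") auto
    with Suc F F' show ?case by auto
  qed simp
  moreover have "d ^ n * d ^ n = 1"
    using assms(1) by (auto simp flip: power_mult_distrib)
  ultimately show ?thesis by (simp add: algebra_simps)
qed

context circle_lift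
begin

lemma linear_spanning_sets:
  assumes "M \<subseteq> circle" "\<epsilon> > 0"
  shows "\<exists>K. \<forall>n. \<exists>E. spanning_set M f \<epsilon> n E \<and> card E \<le> K * (n + 1)"
proof -
  obtain e :: int where e: "e = 1 \<or> e = - 1" "\<And>t. F (t + 1) = F t + of_int e"
    "strict_mono (\<lambda>t. of_int e * F t)" using monotone by metis
  define d where "d = real_of_int e"
  have d: "d = 1 \<or> d = - 1" "\<And>t. F (t + 1) = F t + d" "strict_mono (\<lambda>t. d * F t)"
    using e by (auto simp: d_def)
  define G where "G i t = d ^ i * (F ^^ i) t" for i t
  have G_mono: "mono (G i)" for i
    using signed_funpow_strict_mono[OF d(1,3), of i] unfolding G_def by (rule strict_mono_mono)
  have G_1: "G i 1 = G i 0 + 1" for i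
    using signed_funpow_degree[of d F i 0] d unfolding G_def by simp
  have abs_d: "\<bar>d ^ i\<bar> = 1" for i using d(1) by (auto simp: power_abs)
  obtain N :: nat where N: "2 * pi / \<epsilon> < real N" using reals_Archimedean2 by blast
  moreover have "0 < 2 * pi / \<epsilon>" using \<open>\<epsilon> > 0\<close> by simp
  ultimately have "real N > 0" by linarith
  have N_eps: "2 * pi / real N \<le> \<epsilon>"
    using N \<open>\<epsilon> > 0\<close> \<open>real N > 0\<close> by (simp add: field_simps)
  have "\<exists>E. spanning_set M f \<epsilon> n E \<and> card E \<le> (N + 1) * (n + 1)" for n
  proof -
    \<comment> \<open>Each summand is nondecreasing in \<open>t\<close>, so \<open>S\<close> is constant exactly where all summands are.
    Its fibres are the intervals cut out by the preimages of the \<open>N\<close> cut points, and there are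
    few of them since \<open>S\<close> grows by only \<open>N (n + 1)\<close> over one turn.\<close>
    define S where "S t = (\<Sum>i\<le>n. \<lfloor>real N * G i t\<rfloor>)" for t
    have fl_mono: "\<lfloor>real N * G i s\<rfloor> \<le> \<lfloor>real N * G i t\<rfloor>" if "s \<le> t" for i s t
      using monoD[OF G_mono that] by (intro floor_mono mult_left_mono) auto
    have S_mono: "S s \<le> S t" if "s \<le> t" for s t
      unfolding S_def using fl_mono that by (intro sum_mono)
    have "\<lfloor>real N * G i 1\<rfloor> = \<lfloor>real N * G i 0\<rfloor> + int N" for i
      by (simp add: G_1 ring_distribs)
    then have S_1: "S 1 = S 0 + int (N * (n + 1))"
      by (simp add: S_def sum.distrib algebra_simps)
    have close: "bowen_dist f n (turn s) (turn t) \<le> \<epsilon>" if "s \<le> t" "S s = S t" for s t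
      unfolding bowen_dist_le_iff
    proof (intro allI impI)
      fix i assume "i \<le> n"
      have "\<lfloor>real N * G i s\<rfloor> = \<lfloor>real N * G i t\<rfloor>"
        using sum_mono_inv[of "\<lambda>i. \<lfloor>real N * G i s\<rfloor>" "{..n}" "\<lambda>i. \<lfloor>real N * G i t\<rfloor>" i]
          that fl_mono \<open>i \<le> n\<close> by (auto simp: S_def)
      then have "\<bar>real N * G i s - real N * G i t\<bar> < 1" by linarith
      then have "real N * \<bar>G i s - G i t\<bar> < 1"
        by (simp add: abs_mult flip: right_diff_distrib)
      moreover have "\<bar>G i s - G i t\<bar> = \<bar>(F ^^ i) s - (F ^^ i) t\<bar>"
        unfolding G_def using abs_d[of i] by (simp add: abs_mult flip: right_diff_distrib)
      ultimately have "\<bar>(F ^^ i) s - (F ^^ i) t\<bar> \<le> 1 / real N"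
        using \<open>real N > 0\<close> by (simp add: field_simps)
      then have "2 * pi * \<bar>(F ^^ i) s - (F ^^ i) t\<bar> \<le> 2 * pi * (1 / real N)"
        by (intro mult_left_mono) auto
      then have "2 * pi * \<bar>(F ^^ i) s - (F ^^ i) t\<bar> \<le> \<epsilon>" using N_eps by simp
      then show "dist ((f ^^ i) (turn s)) ((f ^^ i) (turn t)) \<le> \<epsilon>"
        using dist_turn_le[of "(F ^^ i) s" "(F ^^ i) t"] by (simp add: turn_lift_funpow)
    qed
    define piece where "piece k = turn ` {t. 0 \<le> t \<and> t \<le> 1 \<and> S t = k}" for k
    define \<P> where "\<P> = piece ` {S 0..S 1}"
    have "card \<P> \<le> card {S 0..S 1}" unfolding \<P>_def by (rule card_image_le) simp
    also have "\<dots> = N * (n + 1) + 1" unfolding S_1 card_atLeastAtMost_int by linarith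
    also have "\<dots> \<le> (N + 1) * (n + 1)" by simp
    finally have card: "card \<P> \<le> (N + 1) * (n + 1)" .
    have "finite \<P>" by (simp add: \<P>_def)
    moreover have "circle \<subseteq> \<Union>\<P>"
    proof
      fix z assume "z \<in> circle"
      then obtain t where t: "z = turn t" "0 \<le> t" "t < 1" by (rule circle_turnE)
      then have "S t \<in> {S 0..S 1}" using S_mono by simp
      moreover have "z \<in> piece (S t)" unfolding piece_def using t by auto
      ultimately show "z \<in> \<Union>\<P>" unfolding \<P>_def by blast
    qed
    moreover have "bowen_dist f n x y \<le> \<epsilon>" if "P \<in> \<P>" "x \<in> P" "y \<in> P" for P x y
    proof -
      obtain k where "P = piece k" using \<open>P \<in> \<P>\<close> unfolding \<P>_def by blast
      then obtain s t where st: "x = turn s" "y = turn t" "S s = S t"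
        using \<open>x \<in> P\<close> \<open>y \<in> P\<close> unfolding piece_def by auto
      show ?thesis
      proof (cases "s \<le> t")
        case True then show ?thesis using close[of s t] st by simp
      next
        case False then show ?thesis
          using close[of t s] st unfolding bowen_dist_commute[of f n x y] by simp
      qed
    qed
    moreover have "M \<subseteq> \<Union>\<P>" using \<open>circle \<subseteq> \<Union>\<P>\<close> assms(1) by (rule order_trans[rotated])
    ultimately obtain E where "spanning_set M f \<epsilon> n E" "card E \<le> card \<P>"
      using spanning_set_of_cover[of \<P> M f n \<epsilon>] by (metis IntD1)
    then show ?thesis using card order_trans by blast
  qed
  then show ?thesis by blast
qed

end

lemma linear_spanning_sets:
  assumes "circle_homeo f" "M \<subseteq> circle" "\<epsilon> > 0"
  shows "\<exists>K. \<forall>n. \<exists>E. spanning_set M f \<epsilon> n E \<and> card E \<le> K * (n + 1)"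
proof -
  obtain F where "is_lift F f" using lift_exists assms(1) by blast
  then interpret circle_lift f F using assms(1) by unfold_locales
  show ?thesis using assms(2,3) by (rule linear_spanning_sets)
qed

lemma gen_entropy_linear_of_separated:
  assumes "circle_homeo f" "M \<subseteq> circle" "\<epsilon> > 0"
    and p: "\<And>i. p i \<in> M"
    and sep: "\<And>i j n. i \<le> n \<Longrightarrow> j \<le> n \<Longrightarrow> i \<noteq> j \<Longrightarrow> \<epsilon> \<le> bowen_dist f n (p i) (p j)"
  shows "gen_entropy M f = order_linear"
proof (rule gen_entropy_eq_linearI)
  show "\<exists>K. \<forall>n. \<exists>E. spanning_set M f \<epsilon> n E \<and> card E \<le> K * (n + 1)" if "\<epsilon> > 0" for \<epsilon>
    using assms(1,2) that by (rule linear_spanning_sets)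
  \<comment> \<open>Any scale strictly below \<open>\<epsilon> / 2\<close> would do.\<close>
  show "\<epsilon> / 3 > 0" using \<open>\<epsilon> > 0\<close> by simp
  fix n
  have "card {..n} \<le> spanning_number M f (\<epsilon> / 3) n"
  proof -
    obtain E where "spanning_set M f (\<epsilon> / 3) n E"
      using linear_spanning_sets[OF assms(1,2) \<open>\<epsilon> / 3 > 0\<close>] by blast
    then show ?thesis
    proof (rule card_separated_le_spanning_number[where p = p])
      show "2 * (\<epsilon> / 3) < bowen_dist f n (p i) (p j)" if "i \<in> {..n}" "j \<in> {..n}" "i \<noteq> j" for i j
        using sep[of i n j] that \<open>\<epsilon> > 0\<close> by simp
    qed (rule p)
  qed
  then show "n \<le> spanning_number M f (\<epsilon> / 3) n" by simp
qed

text \<open>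
  Choose \<open>p j\<close> with \<open>f\<^sup>j (p j) = x\<close>. At time \<open>j\<close> the orbit of \<open>p j\<close> is at \<open>x\<close>, while for
  \<open>i < j\<close> the orbit of \<open>p i\<close> passed through \<open>x\<close> before and cannot be back in the wandering neighbourhood.
\<close>

lemma gen_entropy_linear_of_wandering:
  assumes "circle_homeo f" "x \<in> circle" "x \<notin> nonwandering circle f"
  shows "gen_entropy circle f = order_linear"
proof -
  obtain U where U: "openin (top_of_set circle) U" "x \<in> U" "\<And>n. n \<ge> 1 \<Longrightarrow> (f ^^ n) ` U \<inter> U = {}"
    using assms(2,3) unfolding nonwandering_def by blast
  obtain r where r: "r > 0" "ball x r \<inter> circle \<subseteq> U"
    using U(1,2) by (meson openin_contains_ball)
  have "\<exists>p. p \<in> circle \<and> (f ^^ j) p = x" for j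
    using funpow_circle(1)[OF assms(1), of j] assms(2) by (metis imageE)
  then obtain p where p: "\<And>j. p j \<in> circle" "\<And>j. (f ^^ j) (p j) = x" by metis
  have sep: "r \<le> bowen_dist f n (p i) (p j)" if "i < j" "j \<le> n" for i j n
  proof -
    have "(f ^^ j) (p i) = (f ^^ (j - i)) ((f ^^ i) (p i))"
      using \<open>i < j\<close> by (metis add_diff_inverse_nat add.commute comp_apply funpow_add less_imp_le_nat not_less)
    then have "(f ^^ j) (p i) \<in> (f ^^ (j - i)) ` U" using p(2) U(2) by simp
    moreover have "(f ^^ (j - i)) ` U \<inter> U = {}" using U(3)[of "j - i"] \<open>i < j\<close> by simp
    ultimately have "(f ^^ j) (p i) \<notin> U" by blast
    then have "(f ^^ j) (p i) \<notin> ball x r"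
      using r(2) funpow_in_circle[OF assms(1) p(1)] by blast
    then have "r \<le> dist ((f ^^ j) (p i)) ((f ^^ j) (p j))" by (simp add: p(2) dist_commute)
    also have "\<dots> \<le> bowen_dist f n (p i) (p j)" using that(2) by (rule dist_iterate_le_bowen_dist)
    finally show ?thesis .
  qed
  show ?thesis
  proof (rule gen_entropy_linear_of_separated[OF assms(1) order_refl r(1) p(1)])
    fix i j n :: nat assume "i \<le> n" "j \<le> n" "i \<noteq> j"
    then show "r \<le> bowen_dist f n (p i) (p j)"
      using sep[of i j n] sep[of j i n] bowen_dist_commute[of f n "p i" "p j"]
      by (cases "i < j") simp_all
  qed
qed

section \<open>Homeomorphisms with periodic points\<close>

lemma monotone_orbit_limit:
  fixes G :: "real \<Rightarrow> real"
  assumes "continuous_on UNIV G" "mono G" "G a = a" "G b = b" "a \<le> t" "t \<le> b"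
  obtains c where "G c = c" "(\<lambda>l. (G ^^ l) t) \<longlonglongrightarrow> c"
proof -
  have fixed: "(G ^^ l) x = x" if "G x = x" for l x
    using that by (induction l) auto
  have mono_iter: "(G ^^ l) x \<le> (G ^^ l) y" if "x \<le> y" for l x y
    using that monoD[OF assms(2)] by (induction l) auto
  have "a \<le> (G ^^ l) t" "(G ^^ l) t \<le> b" for l
    using mono_iter[OF assms(5), of l] mono_iter[OF assms(6), of l] fixed assms(3,4) by simp_all
  then have "norm ((G ^^ l) t) \<le> max \<bar>a\<bar> \<bar>b\<bar>" for l
    by (smt (verit) real_norm_def)
  then have "Bseq (\<lambda>l. (G ^^ l) t)" by (rule BseqI')
  moreover have "monoseq (\<lambda>l. (G ^^ l) t)"
  proof (cases "t \<le> G t")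
    case True
    have "(G ^^ l) t \<le> (G ^^ Suc l) t" for l
      using mono_iter[OF True, of l] by (simp add: funpow_swap1)
    then show ?thesis unfolding monoseq_Suc by blast
  next
    case False
    have "(G ^^ Suc l) t \<le> (G ^^ l) t" for l
      using mono_iter[of "G t" t l] False by (simp add: funpow_swap1)
    then show ?thesis unfolding monoseq_Suc by blast
  qed
  ultimately have "convergent (\<lambda>l. (G ^^ l) t)" by (rule Bseq_monoseq_convergent)
  then obtain c where c: "(\<lambda>l. (G ^^ l) t) \<longlonglongrightarrow> c" by (auto simp: convergent_def)
  then have "(\<lambda>l. G ((G ^^ l) t)) \<longlonglongrightarrow> G c"
    by (rule continuous_on_tendsto_compose[OF assms(1)]) auto
  moreover have "(\<lambda>l. G ((G ^^ l) t)) \<longlonglongrightarrow> c" using LIMSEQ_Suc[OF c] by simp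
  ultimately have "G c = c" by (rule LIMSEQ_unique)
  with c show thesis by (intro that)
qed

text \<open>
  This makes \<open>turn\<close> a local homeomorphism in a quantitative form: a point of the circle near \<open>turn t\<close>
  has a representative near \<open>t\<close>.
\<close>

lemma near_turnE:
  assumes "0 < \<eta>" "\<eta> \<le> 1 / 2"
    and y: "y \<in> circle" "dist y (turn t) < 2 * sin (pi * \<eta>)"
  obtains t' where "y = turn t'" "\<bar>t' - t\<bar> < \<eta>"
proof -
  obtain s where s: "y = turn s" using y(1) by (rule circle_turnE)
  define t' where "t' = s - of_int (round (s - t))"
  have y': "y = turn t'" unfolding s t'_def by (simp add: turn_eq_iff)
  have "\<bar>t' - t\<bar> \<le> 1 / 2"
    using of_int_round_abs_le[of "s - t"] unfolding t'_def by (simp add: abs_if split: if_splits)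
  moreover have "\<bar>t' - t\<bar> < \<eta>"
  proof (rule ccontr)
    assume "\<not> \<bar>t' - t\<bar> < \<eta>"
    then have "2 * sin (pi * \<eta>) \<le> dist (turn t') (turn t)"
      using dist_turn_ge[of \<eta> t' t] dist_turn_ge[of \<eta> t t'] \<open>\<bar>t' - t\<bar> \<le> 1 / 2\<close> assms(1)
      by (cases "t \<le> t'") (auto simp: dist_commute)
    then show False using y(2) y' by simp
  qed
  ultimately show thesis using that y' by blast
qed

lemma sin_pi_pos: "0 < \<eta> \<Longrightarrow> \<eta> \<le> 1 / 2 \<Longrightarrow> 0 < sin (pi * \<eta>)"
proof (rule sin_gt_zero)
  assume "0 < \<eta>" "\<eta> \<le> 1 / 2"
  then have "pi * \<eta> < pi * 1" by (intro mult_strict_left_mono) auto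
  then show "pi * \<eta> < pi" by simp
qed auto

text \<open>
  Continuity of finitely many iterates at \<open>u\<close>, with one constant serving both as the radius around \<open>u\<close>
  and as the distance kept from \<open>v\<close>.
\<close>

lemma iterates_avoid:
  assumes "circle_homeo f" "u \<in> circle" "finite I" "\<And>r. r \<in> I \<Longrightarrow> (f ^^ r) u \<noteq> v"
  shows "\<exists>e>0. \<forall>r\<in>I. \<forall>w\<in>circle. dist w u < e \<longrightarrow> e \<le> dist ((f ^^ r) w) v"
  using assms(3,4)
proof (induction I rule: finite_induct)
  case empty show ?case by (auto intro: exI[of _ 1])
next
  case (insert r I)
  then obtain e where e: "e > 0" "\<And>r w. \<lbrakk>r \<in> I; w \<in> circle; dist w u < e\<rbrakk> \<Longrightarrow> e \<le> dist ((f ^^ r) w) v"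
    by (metis insertCI)
  define D where "D = dist ((f ^^ r) u) v / 2"
  have "D > 0" using insert.prems[of r] by (simp add: D_def)
  then obtain \<delta> where \<delta>: "\<delta> > 0"
    "\<And>w. \<lbrakk>w \<in> circle; dist w u < \<delta>\<rbrakk> \<Longrightarrow> dist ((f ^^ r) w) ((f ^^ r) u) < D"
    using funpow_circle(2)[OF assms(1), of r] assms(2) unfolding continuous_on_iff by metis
  have far: "D \<le> dist ((f ^^ r) w) v" if "w \<in> circle" "dist w u < \<delta>" for w
    using \<delta>(2)[OF that] dist_triangle[of "(f ^^ r) u" v "(f ^^ r) w"]
    unfolding D_def dist_commute[of "(f ^^ r) u" "(f ^^ r) w"] by linarith
  have "\<forall>r'\<in>insert r I. \<forall>w\<in>circle. dist w u < min e (min \<delta> D) \<longrightarrow> min e (min \<delta> D) \<le> dist ((f ^^ r') w) v"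
  proof (intro ballI impI)
    fix r' w assume "r' \<in> insert r I" "w \<in> circle" "dist w u < min e (min \<delta> D)"
    then show "min e (min \<delta> D) \<le> dist ((f ^^ r') w) v"
      using far[of w] e(2)[of r' w] by (cases "r' = r") (auto simp: min_le_iff_disj)
  qed
  moreover have "min e (min \<delta> D) > 0" using e(1) \<delta>(1) \<open>D > 0\<close> by simp
  ultimately show ?case by blast
qed

text \<open>
  Points near \<open>x\<close> can return close to \<open>x\<close> neither early nor late. Not early, since \<open>x\<close> is not periodic:
  its orbit along multiples of \<open>q\<close> converges to \<open>p \<noteq> x\<close>. Not late, since by then they follow the orbit of
  \<open>p\<close>, which is periodic and avoids \<open>x\<close>. This treats both orientations of \<open>f\<close> at once.
\<close>

lemma wandering_of_uniform_attraction:
  assumes homeo: "circle_homeo f" and "x \<in> circle" "p \<in> circle" "q \<ge> 1"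
    and p: "(f ^^ q) p = p" and x: "(f ^^ q) x \<noteq> x" and "d > 0"
    and attr: "\<And>e. e > 0 \<Longrightarrow> \<exists>L. \<forall>l\<ge>L. \<forall>y\<in>circle. dist y x < d \<longrightarrow> dist ((f ^^ (q * l)) y) p < e"
  shows "x \<notin> nonwandering circle f"
proof -
  have mult_period: "(f ^^ (k * n)) y = y" if "(f ^^ n) y = y" for k n y
    using that by (induction k) (auto simp: funpow_add)
  have aperiodic: "(f ^^ n) x \<noteq> x" if "n \<ge> 1" for n
  proof
    assume per: "(f ^^ n) x = x"
    have "dist x p > 0" using p x by auto
    then obtain L where L: "\<And>l. l \<ge> L \<Longrightarrow> dist ((f ^^ (q * l)) x) p < dist x p"
      using attr[of "dist x p"] \<open>d > 0\<close> assms(2) by (metis dist_self)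
    \<comment> \<open>Evaluating the attraction at the multiple \<open>L n\<close>, where the orbit has returned to \<open>x\<close>.\<close>
    have "L \<le> L * n" using that by simp
    then show False using L[of "L * n"] mult_period[OF per, of "q * L"] by (simp add: mult.assoc)
  qed
  have "(f ^^ r) p \<noteq> x" for r
  proof
    assume r: "(f ^^ r) p = x"
    have "(f ^^ q) ((f ^^ r) p) = (f ^^ r) ((f ^^ q) p)"
      by (metis add.commute comp_apply funpow_add)
    with r p x show False by simp
  qed
  then obtain e where e: "e > 0"
    "\<And>r w. \<lbrakk>r < q; w \<in> circle; dist w p < e\<rbrakk> \<Longrightarrow> e \<le> dist ((f ^^ r) w) x"
    using iterates_avoid[OF homeo assms(3), of "{..<q}" x] by auto
  obtain L where L: "\<And>l y. \<lbrakk>l \<ge> L; y \<in> circle; dist y x < d\<rbrakk> \<Longrightarrow> dist ((f ^^ (q * l)) y) p < e"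
    using attr[OF e(1)] by blast
  obtain e' where e': "e' > 0"
    "\<And>r w. \<lbrakk>1 \<le> r; r < q * L; w \<in> circle; dist w x < e'\<rbrakk> \<Longrightarrow> e' \<le> dist ((f ^^ r) w) x"
    using iterates_avoid[OF homeo assms(2), of "{1..<q * L}" x] aperiodic by auto
  define r where "r = min d (min e e')"
  define U where "U = circle \<inter> ball x r"
  have "r > 0" using \<open>d > 0\<close> e(1) e'(1) by (simp add: r_def)
  have "openin (top_of_set circle) U" unfolding U_def by (rule openin_open_Int) simp
  moreover have "x \<in> U" using \<open>r > 0\<close> assms(2) by (simp add: U_def)
  moreover have "(f ^^ n) ` U \<inter> U = {}" if "n \<ge> 1" for n
  proof -
    have "(f ^^ n) y \<notin> U" if "y \<in> U" for y
    proof (cases "n < q * L")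
      case True
      then have "e' \<le> dist ((f ^^ n) y) x"
        using e'(2)[of n y] \<open>n \<ge> 1\<close> that by (auto simp: U_def r_def dist_commute)
      then show ?thesis by (auto simp: U_def r_def dist_commute)
    next
      case False
      define l where "l = n div q"
      have "L \<le> l" using False assms(4) unfolding l_def
        by (metis div_le_mono mult.commute nonzero_mult_div_cancel_right not_less not_one_le_zero)
      have "n = n mod q + q * l" unfolding l_def by simp
      then have eq: "(f ^^ n) y = (f ^^ (n mod q)) ((f ^^ (q * l)) y)"
        by (metis comp_apply funpow_add)
      have y: "y \<in> circle" "dist y x < d" using that by (auto simp: U_def r_def dist_commute)
      have "e \<le> dist ((f ^^ (n mod q)) ((f ^^ (q * l)) y)) x"
        using e(2)[OF _ funpow_in_circle[OF homeo y(1)] L[OF \<open>L \<le> l\<close> y]] assms(4) by simp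
      then show ?thesis unfolding eq by (auto simp: U_def r_def dist_commute)
    qed
    then show ?thesis by blast
  qed
  ultimately show ?thesis unfolding nonwandering_def by blast
qed

text \<open>
  A suitable even iterate has an increasing lift \<open>G\<close> with a fixed point, hence with fixed points to both
  sides of any \<open>t\<close>. If \<open>t\<close> is not fixed, the orbits under \<open>G\<close> of its neighbours \<open>G\<^sup>-\<^sup>1 t\<close> and \<open>G t\<close>
  are shifts of the orbit of \<open>t\<close> and have the same limit, so the interval between them is attracted
  uniformly.
\<close>

lemma nonwandering_imp_common_period:
  assumes "circle_homeo f" "has_periodic_points circle f"
  obtains Q where "Q \<ge> 1" "\<And>x. x \<in> nonwandering circle f \<Longrightarrow> (f ^^ Q) x = x"
proof -
  obtain F where "is_lift F f" using lift_exists assms(1) by blast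
  then interpret circle_lift f F using assms(1) by unfold_locales
  obtain e :: int where e: "e = 1 \<or> e = - 1" "\<And>t. F (t + 1) = F t + of_int e"
    "strict_mono (\<lambda>t. of_int e * F t)" using monotone by metis
  obtain z q where z: "z \<in> circle" "q \<ge> 1" "(f ^^ q) z = z"
    using assms(2) unfolding has_periodic_points_def by blast
  obtain t0 where t0: "z = turn t0" using z(1) by (rule circle_turnE)
  \<comment> \<open>Doubling the period makes the iterate orientation preserving in all cases.\<close>
  define Q where "Q = 2 * q"
  have "Q \<ge> 1" using z(2) by (simp add: Q_def)
  have sgn: "real_of_int e ^ Q = 1" using e(1) by (auto simp: Q_def)
  have FQ_mono: "strict_mono (F ^^ Q)"
    using signed_funpow_strict_mono[of "real_of_int e" F Q] e(1,3) sgn by auto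
  have FQ_1: "(F ^^ Q) (t + 1) = (F ^^ Q) t + 1" for t
    using signed_funpow_degree[of "real_of_int e" F Q t] e(1,2) sgn by auto
  have "(f ^^ Q) z = z" unfolding Q_def mult_2 funpow_add using z(3) by simp
  then have "turn ((F ^^ Q) t0) = turn t0" unfolding t0 turn_lift_funpow .
  then obtain m :: int where m: "(F ^^ Q) t0 = t0 + of_int m"
    unfolding turn_eq_iff by (metis Ints_cases add.commute diff_add_cancel)
  define G where "G t = (F ^^ Q) t - of_int m" for t
  have G_mono: "strict_mono G" using FQ_mono by (auto simp: G_def strict_mono_def)
  have F_iter_cont: "continuous_on UNIV (F ^^ n)" for n
  proof (induction n)
    case (Suc n)
    then show ?case using continuous_on_compose[of UNIV "F ^^ n" F] cont by simp
  qed (simp add: continuous_on_id)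
  have G_cont: "continuous_on S G" for S
    unfolding G_def by (intro continuous_intros continuous_on_subset[OF F_iter_cont]) auto
  have turn_G: "turn (G t) = (f ^^ Q) (turn t)" for t
    using turn_add_int[of "(F ^^ Q) t" "- m"] by (simp add: G_def turn_lift_funpow)
  have turn_G_iter: "turn ((G ^^ l) t) = (f ^^ (Q * l)) (turn t)" for l t
    by (induction l) (simp_all add: turn_G funpow_add)
  have G_1: "G (t + 1) = G t + 1" for t using FQ_1[of t] by (simp add: G_def)
  have G_nat: "G (t + real n) = G t + real n" for t n
  proof (induction n)
    case (Suc n) then show ?case using G_1[of "t + real n"] by (simp add: algebra_simps)
  qed simp
  have G_int: "G (t + of_int k) = G t + of_int k" for t k
    using G_nat[of t "nat k"] G_nat[of "t + of_int k" "nat (- k)"] by (cases "k \<ge> 0") auto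
  have G_fixed: "G (t0 + of_int k) = t0 + of_int k" for k
    unfolding G_int using m by (simp add: G_def)
  have G_iter_mono: "strict_mono (G ^^ l)" for l
    using signed_funpow_strict_mono[of 1 G l] G_mono by simp
  have "x \<notin> nonwandering circle f" if "x \<in> circle" "(f ^^ Q) x \<noteq> x" for x
  proof -
    obtain t where t: "x = turn t" using \<open>x \<in> circle\<close> by (rule circle_turnE)
    have Gt: "G t \<noteq> t" using that(2) unfolding t by (metis turn_G)
    define a where "a = t0 + of_int \<lfloor>t - t0\<rfloor>"
    define b where "b = t0 + of_int (\<lfloor>t - t0\<rfloor> + 1)"
    have "G a = a" "G b = b" unfolding a_def b_def by (rule G_fixed)+
    moreover have "a \<le> t" "t \<le> b" unfolding a_def b_def by linarith+
    ultimately have ab: "a \<le> t" "t \<le> b" "G a = a" "G b = b" by blast+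
    obtain s where s: "G s = t"
      using IVT'[of G a t b] ab G_cont by auto
    obtain c where c: "G c = c" "(\<lambda>l. (G ^^ l) t) \<longlonglongrightarrow> c"
      using monotone_orbit_limit[OF G_cont strict_mono_mono[OF G_mono] ab(3,4,1,2)] .
    have lim_u: "(\<lambda>l. (G ^^ l) (G t)) \<longlonglongrightarrow> c"
      using LIMSEQ_Suc[OF c(2)] by (simp add: funpow_swap1)
    have "(\<lambda>l. (G ^^ Suc l) s) \<longlonglongrightarrow> c"
      using c(2) s by (simp add: funpow_swap1)
    then have lim_s: "(\<lambda>l. (G ^^ l) s) \<longlonglongrightarrow> c" by (rule LIMSEQ_imp_Suc)
    define lo where "lo = min s (G t)"
    define hi where "hi = max s (G t)"
    have between: "lo < t" "t < hi"
      using Gt s strict_mono_less[OF G_mono, of s t] strict_mono_less[OF G_mono, of t s]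
      unfolding lo_def hi_def by (auto simp: min_less_iff_disj less_max_iff_disj)
    have lim: "(\<lambda>l. (G ^^ l) lo) \<longlonglongrightarrow> c" "(\<lambda>l. (G ^^ l) hi) \<longlonglongrightarrow> c"
      using lim_s lim_u by (auto simp: lo_def hi_def min_def max_def)
    define \<eta> where "\<eta> = min (1 / 2) (min (t - lo) (hi - t))"
    have \<eta>: "0 < \<eta>" "\<eta> \<le> 1 / 2" "\<eta> \<le> t - lo" "\<eta> \<le> hi - t"
      using between unfolding \<eta>_def by linarith+
    show ?thesis
    proof (rule wandering_of_uniform_attraction[OF assms(1) that(1) turn_in_circle \<open>Q \<ge> 1\<close>])
      show "(f ^^ Q) (turn c) = turn c" using turn_G[of c] c(1) by simp
      show "(f ^^ Q) x \<noteq> x" by fact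
      show "0 < 2 * sin (pi * \<eta>)" using sin_pi_pos[OF \<eta>(1,2)] by simp
      fix \<epsilon> :: real assume "\<epsilon> > 0"
      then have "0 < \<epsilon> / (2 * pi)" by simp
      from LIMSEQ_D[OF lim(1) this] LIMSEQ_D[OF lim(2) this]
      obtain L1 L2 where L: "\<And>l. l \<ge> L1 \<Longrightarrow> \<bar>(G ^^ l) lo - c\<bar> < \<epsilon> / (2 * pi)"
        "\<And>l. l \<ge> L2 \<Longrightarrow> \<bar>(G ^^ l) hi - c\<bar> < \<epsilon> / (2 * pi)" by auto
      have "dist ((f ^^ (Q * l)) y) (turn c) < \<epsilon>"
        if l: "l \<ge> max L1 L2" and y: "y \<in> circle" "dist y x < 2 * sin (pi * \<eta>)" for l y
      proof -
        obtain t' where t': "y = turn t'" "\<bar>t' - t\<bar> < \<eta>"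
          using near_turnE[OF \<eta>(1,2) y(1)] y(2) t by metis
        then have "lo < t'" "t' < hi" using \<eta>(3,4) by auto
        then have "(G ^^ l) lo < (G ^^ l) t'" "(G ^^ l) t' < (G ^^ l) hi"
          using strict_monoD[OF G_iter_mono] by auto
        then have "\<bar>(G ^^ l) t' - c\<bar> < \<epsilon> / (2 * pi)" using L[of l] l by auto
        then have "2 * pi * \<bar>(G ^^ l) t' - c\<bar> < \<epsilon>"
          by (simp add: field_simps)
        then show ?thesis
          using dist_turn_le[of "(G ^^ l) t'" c] t'(1) by (simp add: turn_G_iter)
      qed
      then show "\<exists>L. \<forall>l\<ge>L. \<forall>y\<in>circle. dist y x < 2 * sin (pi * \<eta>) \<longrightarrow>
          dist ((f ^^ (Q * l)) y) (turn c) < \<epsilon>" by blast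
    qed
  qed
  then show thesis
    using that[of Q] \<open>Q \<ge> 1\<close> nonwandering_subset[of circle f] by blast
qed

lemma periodic_imp_nonwandering:
  assumes "x \<in> M" "q \<ge> 1" "(f ^^ q) x = x"
  shows "x \<in> nonwandering M f"
  using assms unfolding nonwandering_def by (auto simp: disjoint_iff intro!: exI[of _ q]) (metis)

text \<open>
  The common period makes \<open>f\<close> Lyapunov stable on the nonwandering set. Whether it is so on the whole circle
  depends only on the existence of a wandering point.
\<close>

lemma entropy_numbers_of_periodic:
  assumes "circle_homeo f" "has_periodic_points circle f"
  shows "entropy_numbers circle f = (order_zero, order_zero) \<and> lyapunov_stable circle f \<or>
         entropy_numbers circle f = (order_zero, order_linear) \<and> \<not> lyapunov_stable circle f"
proof -
  obtain Q where Q: "Q \<ge> 1" "\<And>x. x \<in> nonwandering circle f \<Longrightarrow> (f ^^ Q) x = x"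
    using nonwandering_imp_common_period[OF assms] by blast
  have sub: "nonwandering circle f \<subseteq> circle" by (rule nonwandering_subset)
  have ne: "nonwandering circle f \<noteq> {}"
    using assms(2) periodic_imp_nonwandering unfolding has_periodic_points_def by blast
  have stable: "lyapunov_stable (nonwandering circle f) f"
    using Q uniformly_continuous_funpow[OF assms(1) sub] by (rule lyapunov_stable_of_period)
  have zero: "gen_entropy (nonwandering circle f) f = order_zero"
    using lyapunov_stable_imp_gen_entropy_zero[of circle, OF _ sub ne stable] by simp
  show ?thesis
  proof (cases "nonwandering circle f = circle")
    case True
    then show ?thesis using zero stable by (simp add: entropy_numbers_def)
  next
    case False
    then obtain x where "x \<in> circle" "x \<notin> nonwandering circle f" using sub by blast
    then have linear: "gen_entropy circle f = order_linear"
      by (rule gen_entropy_linear_of_wandering[OF assms(1)])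
    have "\<not> lyapunov_stable circle f"
    proof
      assume "lyapunov_stable circle f"
      then have "gen_entropy circle f = order_zero"
        using lyapunov_stable_imp_gen_entropy_zero[of circle circle f] by simp
      with linear show False using order_zero_neq_order_linear by simp
    qed
    with linear zero show ?thesis by (simp add: entropy_numbers_def)
  qed
qed

section \<open>Increasing lifts and the rotation number\<close>

locale increasing_lift = circle_lift +
  assumes strict: "strict_mono F"
begin

lemma add_int: "F (t + of_int m) = F t + of_int m"
proof -
  obtain d :: int where d: "d = 1 \<or> d = - 1" "\<And>t. F (t + 1) = F t + of_int d"
    using monotone by metis
  have "F 0 < F (0 + 1)" using strict by (simp add: strict_mono_less)
  then have "d = 1" using d(1) d(2)[of 0] by auto
  then show ?thesis using add_int_degree[of d t m] d(2) by simp
qed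

lemma funpow_add_int: "(F ^^ n) (t + of_int m) = (F ^^ n) t + of_int m"
  by (induction n) (simp_all add: add_int)

lemma funpow_less_iff: "(F ^^ n) s < (F ^^ n) t \<longleftrightarrow> s < t"
  by (induction n) (simp_all add: strict_mono_less[OF strict])

lemma funpow_le_iff: "(F ^^ n) s \<le> (F ^^ n) t \<longleftrightarrow> s \<le> t"
  by (induction n) (simp_all add: strict_mono_less_eq[OF strict])

lemma cont_funpow: "continuous_on UNIV (F ^^ n)"
proof (induction n)
  case (Suc n)
  then show ?case using continuous_on_compose[of UNIV "F ^^ n" F] cont by simp
qed (simp add: continuous_on_id)

lemma funpow_surj: "\<exists>t. (F ^^ n) t = y"
proof -
  define k where "k = \<lfloor>y - (F ^^ n) 0\<rfloor>"
  have "(F ^^ n) (0 + of_int k) \<le> y" "y \<le> (F ^^ n) (0 + of_int (k + 1))"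
    unfolding funpow_add_int k_def by linarith+
  then show ?thesis
    using IVT'[of "F ^^ n" "0 + of_int k" y "0 + of_int (k + 1)"] continuous_on_subset[OF cont_funpow]
    by auto
qed

text \<open>
  Both points can be compared after an integer translation, which commutes with \<open>F\<close>.
\<close>

lemma displacement_le: "(F ^^ n) s - s \<le> (F ^^ n) t - t + 1"
proof -
  define m where "m = \<lceil>s - t\<rceil>"
  have m: "s \<le> t + of_int m" "of_int m < s - t + 1" unfolding m_def by linarith+
  then have "(F ^^ n) s \<le> (F ^^ n) t + of_int m"
    using funpow_le_iff[of n s "t + of_int m"] by (simp add: funpow_add_int)
  with m(2) show ?thesis by linarith
qed

text \<open>
  Up to an error of \<open>1\<close> the sequence \<open>F\<^sup>n 0\<close> is additive, so \<open>F\<^sup>n 0 + 1\<close> is subadditive and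
  \<open>F\<^sup>n 0 - 1\<close> is superadditive. Hence every quotient \<open>(F\<^sup>m 0 - 1) / m\<close> lies below every
  \<open>(F\<^sup>n 0 + 1) / n\<close>, and any \<open>\<rho>\<close> in between works. The deviation bound is stronger than
  convergence of \<open>F\<^sup>n t / n\<close> and is what makes the limes superior below finite.
\<close>

lemma rotation_number_exists:
  obtains \<rho> where "\<And>n t. \<bar>(F ^^ n) t - t - real n * \<rho>\<bar> \<le> 2"
proof -
  define a where "a n = (F ^^ n) 0" for n
  have add: "a (m + n) \<le> a m + a n + 1" "a m + a n - 1 \<le> a (m + n)" for m n
    using displacement_le[of m "a n" 0] displacement_le[of m 0 "a n"]
    by (simp_all add: a_def funpow_add)
  have mult: "a (k * n) \<le> real k * (a n + 1)" "real k * (a n - 1) \<le> a (k * n)" for k n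
  proof (induction k)
    case 0
    { case 1 show ?case by (simp add: a_def) next case 2 show ?case by (simp add: a_def) }
  next
    case (Suc k)
    { case 1 show ?case using Suc(1) add(1)[of n "k * n"] by (simp add: algebra_simps)
    next case 2 show ?case using Suc(2) add(2)[of n "k * n"] by (simp add: algebra_simps) }
  qed
  have between: "(a m - 1) / real m \<le> (a n + 1) / real n" if "m \<ge> 1" "n \<ge> 1" for m n
  proof -
    have "real n * (a m - 1) \<le> real m * (a n + 1)"
      using mult(2)[of n m] mult(1)[of m n] by (simp add: mult.commute)
    then show ?thesis using that by (simp add: field_simps)
  qed
  define \<rho> where "\<rho> = (SUP m\<in>{1..}. (a m - 1) / real m)"
  have up: "\<rho> \<le> (a n + 1) / real n" if "n \<ge> 1" for n
    unfolding \<rho>_def using between that by (intro cSUP_least) auto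
  have low: "(a n - 1) / real n \<le> \<rho>" if "n \<ge> 1" for n
    unfolding \<rho>_def using between[of _ 1] that by (intro cSUP_upper bdd_aboveI2) auto
  have "\<bar>a n - real n * \<rho>\<bar> \<le> 1" for n
  proof (cases "n \<ge> 1")
    case True
    then have "real n * \<rho> \<le> a n + 1" "a n - 1 \<le> real n * \<rho>"
      using up[OF True] low[OF True] by (simp_all add: field_simps)
    then show ?thesis by linarith
  next
    case False
    then have "n = 0" by simp
    then show ?thesis by (simp add: a_def)
  qed
  then have "\<bar>(F ^^ n) t - t - real n * \<rho>\<bar> \<le> 2" for n t
    using displacement_le[of n t 0] displacement_le[of n 0 t] unfolding a_def
    by (smt (verit))
  then show thesis by (rule that)
qed

lemma funpow_over_n_tendsto:
  assumes "\<And>n t. \<bar>(F ^^ n) t - t - real n * \<rho>\<bar> \<le> 2"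
  shows "(\<lambda>n. (F ^^ n) t / real n) \<longlonglongrightarrow> \<rho>"
proof -
  have "(\<lambda>n. (F ^^ n) t / real n - \<rho>) \<longlonglongrightarrow> 0"
  proof (rule Lim_null_comparison)
    show "\<forall>\<^sub>F n in sequentially. norm ((F ^^ n) t / real n - \<rho>) \<le> (\<bar>t\<bar> + 2) * inverse (real n)"
      using eventually_ge_at_top[of 1]
    proof eventually_elim
      case (elim n)
      have "\<bar>(F ^^ n) t - real n * \<rho>\<bar> \<le> \<bar>t\<bar> + 2" using assms[of n t] by linarith
      moreover have "(F ^^ n) t / real n - \<rho> = ((F ^^ n) t - real n * \<rho>) / real n"
        using elim by (simp add: field_simps)
      ultimately show ?case using elim by (simp add: divide_right_mono flip: divide_inverse)
    qed
    show "(\<lambda>n. (\<bar>t\<bar> + 2) * inverse (real n)) \<longlonglongrightarrow> 0"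
      using tendsto_mult_right_zero[OF lim_inverse_n] by blast
  qed
  then show ?thesis by (simp add: LIM_zero_iff)
qed

text \<open>
  If \<open>\<rho> = p / Q\<close> and no point is periodic, the displacement \<open>F\<^sup>Q t - t - p\<close> has no zero. Being periodic and
  continuous it is bounded away from \<open>0\<close> with constant sign, so under iteration it accumulates beyond the
  allowed deviation.
\<close>

lemma rotation_number_irrational:
  assumes dev: "\<And>n t. \<bar>(F ^^ n) t - t - real n * \<rho>\<bar> \<le> 2"
    and aper: "\<not> has_periodic_points circle f"
  shows "\<rho> \<notin> \<rat>"
proof
  assume "\<rho> \<in> \<rat>"
  then obtain p q :: int where pq: "q > 0" "\<rho> = of_int p / of_int q"
    by (metis Rats_cases')
  define Q where "Q = nat q"
  have Q: "Q \<ge> 1" "real Q * \<rho> = of_int p" using pq by (auto simp: Q_def)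
  define g where "g t = (F ^^ Q) t - t - of_int p" for t
  have g_cont: "continuous_on S g" for S
    unfolding g_def by (intro continuous_intros continuous_on_subset[OF cont_funpow]) auto
  have g_nz: "g t \<noteq> 0" for t
  proof
    assume "g t = 0"
    then have "(F ^^ Q) t = t + of_int p" by (simp add: g_def)
    then have "(f ^^ Q) (turn t) = turn t"
      unfolding turn_lift_funpow[symmetric] by (simp add: turn_add_int)
    with aper Q(1) turn_in_circle[of t] show False unfolding has_periodic_points_def by blast
  qed
  have g_int: "g (t + of_int m) = g t" for t m by (simp add: g_def funpow_add_int)
  have "(\<forall>t. 0 < g t) \<or> (\<forall>t. 0 < - g t)"
  proof (rule ccontr)
    assume "\<not> ?thesis"
    then obtain s t where "g s \<le> 0" "0 \<le> g t" by (auto simp: not_less)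
    then show False
      using IVT'[of g s 0 t] IVT2'[of g s 0 t] g_cont g_nz by (cases "s \<le> t") auto
  qed
  \<comment> \<open>The sign \<open>\<sigma>\<close> allows both directions of displacement to be handled at once.\<close>
  then obtain \<sigma> :: real where \<sigma>: "\<bar>\<sigma>\<bar> = 1" "\<And>t. 0 < \<sigma> * g t"
    by (elim disjE) (auto intro: that[of 1] that[of "-1"])
  have "continuous_on {0..1} (\<lambda>t. \<sigma> * g t)" by (intro continuous_intros g_cont)
  then have "\<exists>t1\<in>{0..1}. \<forall>t\<in>{0..1}. \<sigma> * g t1 \<le> \<sigma> * g t"
    by (intro continuous_attains_inf) auto
  then obtain t1 where t1: "t1 \<in> {0..1}" "\<And>t. t \<in> {0..1} \<Longrightarrow> \<sigma> * g t1 \<le> \<sigma> * g t"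
    by blast
  define \<delta> where "\<delta> = \<sigma> * g t1"
  have "\<delta> > 0" using \<sigma>(2) by (simp add: \<delta>_def)
  have g_ge: "\<delta> \<le> \<sigma> * g t" for t
  proof -
    have "\<delta> \<le> \<sigma> * g (frac t)"
      unfolding \<delta>_def using frac_ge_0[of t] frac_lt_1[of t] by (intro t1(2)) auto
    also have "g (frac t) = g t" using g_int[of t "- \<lfloor>t\<rfloor>"] by (simp add: frac_def)
    finally show ?thesis .
  qed
  have grow: "real k * \<delta> \<le> \<sigma> * ((F ^^ (k * Q)) 0 - real k * of_int p)" for k
  proof (induction k)
    case (Suc k)
    have "(F ^^ (Suc k * Q)) 0 = (F ^^ Q) ((F ^^ (k * Q)) 0)" by (simp add: funpow_add)
    then have "(F ^^ (Suc k * Q)) 0 - real (Suc k) * of_int p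
        = g ((F ^^ (k * Q)) 0) + ((F ^^ (k * Q)) 0 - real k * of_int p)"
      by (simp add: g_def algebra_simps)
    then show ?case using Suc g_ge[of "(F ^^ (k * Q)) 0"] by (simp add: algebra_simps)
  qed simp
  obtain k :: nat where "2 / \<delta> < real k" using reals_Archimedean2 by blast
  then have "2 < real k * \<delta>" using \<open>\<delta> > 0\<close> by (simp add: field_simps)
  also have "\<dots> \<le> \<sigma> * ((F ^^ (k * Q)) 0 - real k * of_int p)" by (rule grow)
  also have "\<dots> \<le> \<bar>\<sigma> * ((F ^^ (k * Q)) 0 - real k * of_int p)\<bar>" by (rule abs_ge_self)
  also have "\<dots> = \<bar>(F ^^ (k * Q)) 0 - real k * of_int p\<bar>" using \<sigma>(1) by (simp add: abs_mult)
  also have "\<dots> \<le> 2" using dev[of "k * Q" 0] Q(2) by (simp add: mult.assoc)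
  finally show False by simp
qed

end

text \<open>
  Orientation-reversing homeomorphisms always have fixed points, so maps without periodic points preserve
  orientation.
\<close>

lemma fixed_point_of_degree_minus_one:
  fixes F :: "real \<Rightarrow> real"
  assumes cont: "\<And>S. continuous_on S F" and F_int: "\<And>m. F (of_int m) = F 0 - of_int m"
  obtains t where "F t = t"
proof -
  define m where "m = \<lceil>\<bar>F 0\<bar>\<rceil>"
  have "F (of_int m) - of_int m \<le> 0" "0 \<le> F (of_int (- m)) - of_int (- m)" "(- m) \<le> m"
    unfolding F_int m_def by (simp_all, linarith+)
  then have "\<exists>t\<ge>of_int (- m). t \<le> of_int m \<and> F t - t = 0"
    by (intro IVT2') (auto intro!: continuous_intros cont)
  then show thesis using that by auto
qed

lemma increasing_lift_exists:
  assumes "circle_homeo f" "\<not> has_periodic_points circle f"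
  obtains F where "increasing_lift f F"
proof -
  obtain F where F: "is_lift F f" using lift_exists assms(1) by blast
  then interpret circle_lift f F using assms(1) by unfold_locales
  obtain d :: int where d: "d = 1 \<or> d = - 1" "\<And>t. F (t + 1) = F t + of_int d"
    "strict_mono (\<lambda>t. of_int d * F t)" using monotone by metis
  have "d \<noteq> - 1"
  proof
    assume "d = - 1"
    then have "F (of_int m) = F 0 - of_int m" for m
      using add_int_degree[of d 0 m] d(2) by simp
    then obtain t where "F t = t" using fixed_point_of_degree_minus_one[of F] cont by blast
    then have "(f ^^ 1) (turn t) = turn t" using turn_lift[of t] by simp
    with assms(2) turn_in_circle[of t] show False unfolding has_periodic_points_def by blast
  qed
  then have "strict_mono F" using d by simp
  then have "increasing_lift f F" by unfold_locales
  then show thesis by (rule that)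
qed


section \<open>The semiconjugacy to an irrational rotation\<close>

lemma continuous_on_circle_of_lift:
  assumes h: "\<And>t. h (turn t) = turn (K t)" and K: "continuous_on UNIV K"
  shows "continuous_on circle h"
  unfolding continuous_on_iff
proof (intro ballI allI impI)
  fix z and e :: real assume "z \<in> circle" "e > 0"
  then obtain t where t: "z = turn t" using circle_turnE by metis
  have "e / (2 * pi) > 0" using \<open>e > 0\<close> by simp
  then obtain \<eta>0 where \<eta>0: "\<eta>0 > 0" "\<And>s. dist s t < \<eta>0 \<Longrightarrow> dist (K s) (K t) < e / (2 * pi)"
    using K unfolding continuous_on_iff by (metis UNIV_I)
  define \<eta> where "\<eta> = min \<eta>0 (1 / 2)"
  have \<eta>: "0 < \<eta>" "\<eta> \<le> 1 / 2" "\<eta> \<le> \<eta>0" using \<eta>0(1) unfolding \<eta>_def by linarith+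
  have "dist (h y) (h z) < e" if y: "y \<in> circle" "dist y z < 2 * sin (pi * \<eta>)" for y
  proof -
    obtain s where s: "y = turn s" "\<bar>s - t\<bar> < \<eta>"
      using near_turnE[OF \<eta>(1,2) y(1)] y(2) t by metis
    then have "\<bar>K s - K t\<bar> < e / (2 * pi)" using \<eta>0(2)[of s] \<eta>(3) by (simp add: dist_real_def)
    then have "2 * pi * \<bar>K s - K t\<bar> < e" by (simp add: field_simps)
    then show ?thesis using dist_turn_le[of "K s" "K t"] by (simp add: h t s(1))
  qed
  then show "\<exists>d>0. \<forall>y\<in>circle. dist y z < d \<longrightarrow> dist (h y) (h z) < e"
    using sin_pi_pos[OF \<eta>(1,2)] by (intro exI[of _ "2 * sin (pi * \<eta>)"]) auto
qed

lemma limsup_add_const: "limsup (\<lambda>n. ereal (u n + c)) = limsup (\<lambda>n. ereal (u n)) + ereal c"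
  using Limsup_add_ereal_right[of sequentially "ereal c" "\<lambda>n. ereal (u n)"] by simp

locale irrational_lift = increasing_lift +
  fixes \<rho> :: real
  assumes dev: "\<bar>(F ^^ n) t - t - real n * \<rho>\<bar> \<le> 2" and irrational: "\<rho> \<notin> \<rat>"
begin

text \<open>
  Any shift-invariant mean of the bounded sequences \<open>F\<^sup>n t - n \<rho>\<close> would semiconjugate \<open>F\<close> to the
  translation by \<open>\<rho>\<close>. The limes superior is a choice that is visibly monotone in \<open>t\<close>.
\<close>

definition H :: "real \<Rightarrow> real" where
  "H t = real_of_ereal (limsup (\<lambda>n. ereal ((F ^^ n) t - real n * \<rho>)))"

lemma limsup_eq_H: "limsup (\<lambda>n. ereal ((F ^^ n) t - real n * \<rho>)) = ereal (H t)"
  and abs_H_minus_le: "\<bar>H t - t\<bar> \<le> 2"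
proof -
  let ?l = "limsup (\<lambda>n. ereal ((F ^^ n) t - real n * \<rho>))"
  have bnd: "t - 2 \<le> (F ^^ n) t - real n * \<rho>" "(F ^^ n) t - real n * \<rho> \<le> t + 2" for n
    using dev[of n t] by linarith+
  have "?l \<le> ereal (t + 2)"
    using bnd(2) by (intro Limsup_bounded always_eventually) auto
  moreover have "ereal (t - 2) \<le> ?l"
    using bnd(1) by (intro le_Limsup always_eventually) auto
  ultimately show "?l = ereal (H t)" "\<bar>H t - t\<bar> \<le> 2"
    unfolding H_def by (cases ?l; auto simp: abs_le_iff)+
qed

lemma H_eqI: "limsup (\<lambda>n. ereal ((F ^^ n) t - real n * \<rho>)) = ereal c \<Longrightarrow> H t = c"
  by (simp add: H_def)

lemma H_mono: "s \<le> t \<Longrightarrow> H s \<le> H t"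
proof -
  assume "s \<le> t"
  then have "ereal (H s) \<le> ereal (H t)"
    unfolding limsup_eq_H[symmetric]
    by (intro Limsup_mono always_eventually) (auto simp: funpow_le_iff)
  then show ?thesis by simp
qed

lemma H_add_int: "H (t + of_int m) = H t + of_int m"
proof (rule H_eqI)
  have "limsup (\<lambda>n. ereal ((F ^^ n) (t + of_int m) - real n * \<rho>))
      = limsup (\<lambda>n. ereal (((F ^^ n) t - real n * \<rho>) + of_int m))"
    by (simp add: funpow_add_int algebra_simps)
  also have "\<dots> = ereal (H t + of_int m)" unfolding limsup_add_const limsup_eq_H by simp
  finally show "limsup (\<lambda>n. ereal ((F ^^ n) (t + of_int m) - real n * \<rho>)) = ereal (H t + of_int m)" .
qed

text \<open>
  Passing from \<open>t\<close> to \<open>F t\<close> shifts the sequence by one step and adds \<open>\<rho>\<close>.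
\<close>

lemma H_F: "H (F t) = H t + \<rho>"
proof (rule H_eqI)
  have "limsup (\<lambda>n. ereal ((F ^^ n) (F t) - real n * \<rho>))
      = limsup (\<lambda>n. ereal (((F ^^ (n + 1)) t - real (n + 1) * \<rho>) + \<rho>))"
    by (simp add: funpow_swap1 algebra_simps)
  also have "\<dots> = limsup (\<lambda>n. ereal ((F ^^ (n + 1)) t - real (n + 1) * \<rho>)) + ereal \<rho>"
    by (rule limsup_add_const)
  also have "limsup (\<lambda>n. ereal ((F ^^ (n + 1)) t - real (n + 1) * \<rho>)) = ereal (H t)"
    unfolding limsup_eq_H[symmetric] by (rule limsup_shift)
  finally show "limsup (\<lambda>n. ereal ((F ^^ n) (F t) - real n * \<rho>)) = ereal (H t + \<rho>)" by simp
qed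

lemma H_funpow: "H ((F ^^ n) t) = H t + real n * \<rho>"
  by (induction n) (simp_all add: H_F algebra_simps)

text \<open>
  Multiples of an irrational number are dense modulo one. The step count \<open>n\<close> is positive because the
  lemma also has to produce returns of nonwandering points.
\<close>

lemma orbit_dense:
  assumes "e > 0"
  obtains n m where "n \<ge> 1" "\<bar>H ((F ^^ n) t + of_int m) - y\<bar> < e"
proof -
  obtain h k where hk: "k > 0" "\<bar>of_int k * \<rho> - of_int h - (y - H t)\<bar> < e"
    using sequence_of_fractional_parts_is_dense[OF irrational \<open>e > 0\<close>] .
  have "H ((F ^^ nat k) t + of_int (- h)) - y = of_int k * \<rho> - of_int h - (y - H t)"
    using hk(1) unfolding H_add_int H_funpow by simp
  then show thesis using that[of "nat k" "- h"] hk by simp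
qed

lemma H_less_imp_less: "H s < H t \<Longrightarrow> s < t"
  using H_mono[of t s] by (meson not_le)

text \<open>
  A monotone function can only be discontinuous by jumping over an interval, and the range of \<open>H\<close> is dense.
\<close>

lemma H_cont: "continuous_on S H"
  unfolding continuous_on_iff
proof (intro ballI allI impI)
  fix x and e :: real assume "e > 0"
  then have e2: "e / 2 > 0" by simp
  obtain a where "\<bar>H a - (H x - e / 2)\<bar> < e / 2" using orbit_dense[OF e2] by metis
  then have a: "H x - e < H a" "H a < H x" by linarith+
  obtain b where "\<bar>H b - (H x + e / 2)\<bar> < e / 2" using orbit_dense[OF e2] by metis
  then have b: "H x < H b" "H b < H x + e" by linarith+
  have ab: "a < x" "x < b" using a b H_less_imp_less by auto
  have "dist (H y) (H x) < e" if "dist y x < min (x - a) (b - x)" for y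
  proof -
    have "a \<le> y" "y \<le> b" using that by (auto simp: dist_real_def)
    then have "H a \<le> H y" "H y \<le> H b" by (simp_all add: H_mono)
    then show ?thesis using a b by (auto simp: dist_real_def)
  qed
  then show "\<exists>d>0. \<forall>y\<in>S. dist y x < d \<longrightarrow> dist (H y) (H x) < e"
    using ab by (intro exI[of _ "min (x - a) (b - x)"]) auto
qed

lemma H_surj: "\<exists>t. H t = y"
proof -
  have "H (y - 2) \<le> y" "y \<le> H (y + 2)"
    using abs_H_minus_le[of "y - 2"] abs_H_minus_le[of "y + 2"] by linarith+
  then show ?thesis using IVT'[of H "y - 2" y "y + 2"] H_cont by auto
qed

text \<open>
  The condition says that \<open>H\<close> distinguishes \<open>X\<close> from the points to its left. So a forward orbit point
  whose \<open>H\<close>-value is slightly below \<open>H X\<close> must itself be slightly to the left of \<open>X\<close>.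
\<close>

lemma nonwandering_of_left_increase:
  assumes "\<And>x. x < X \<Longrightarrow> H x < H X"
  shows "turn X \<in> nonwandering circle f"
proof -
  have "\<exists>n\<ge>1. (f ^^ n) ` U \<inter> U \<noteq> {}" if U: "openin (top_of_set circle) U" "turn X \<in> U" for U
  proof -
    obtain \<eta> where \<eta>: "\<eta> > 0" "\<And>t. \<bar>t - X\<bar> < \<eta> \<Longrightarrow> turn t \<in> U"
      using open_turn_vimage[OF U] by blast
    \<comment> \<open>An orbit point with \<open>H\<close>-value strictly between those of \<open>X - \<eta>\<close> and \<open>X\<close>.\<close>
    define c where "c = (H (X - \<eta>) + H X) / 2"
    have less: "H (X - \<eta>) < H X" using assms \<eta>(1) by simp
    then have "(H X - H (X - \<eta>)) / 2 > 0" by simp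
    from orbit_dense[OF this, of X c] obtain n m where nm: "n \<ge> 1"
      "\<bar>H ((F ^^ n) X + of_int m) - c\<bar> < (H X - H (X - \<eta>)) / 2" .
    define Y where "Y = (F ^^ n) X + of_int m"
    have "H (X - \<eta>) < H Y" "H Y < H X"
      using nm(2) unfolding Y_def c_def by (auto simp: abs_less_iff field_simps)
    then have "X - \<eta> < Y" "Y < X" by (simp_all add: H_less_imp_less)
    then have "turn Y \<in> U" using \<eta> by simp
    moreover have "turn Y = (f ^^ n) (turn X)"
      by (simp only: Y_def turn_add_int turn_lift_funpow)
    ultimately show ?thesis using nm(1) U(2) by (intro exI[of _ n]) auto
  qed
  then show ?thesis unfolding nonwandering_def using turn_in_circle[of X] by blast
qed

lemma semiconjugacy:
  obtains h where "\<And>t. h (turn t) = turn (H t)" "continuous_on circle h" "h ` circle = circle"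
    "\<And>x. x \<in> circle \<Longrightarrow> h (f x) = rotation \<rho> (h x)"
proof -
  define h where "h z = turn (H (SOME t. z = turn t))" for z
  have h: "h (turn t) = turn (H t)" for t
  proof -
    define s where "s = (SOME s. turn t = turn s)"
    have "turn t = turn s" unfolding s_def by (rule someI[of _ t]) simp
    then obtain m where "t - s = of_int m" unfolding turn_eq_iff by (auto elim: Ints_cases)
    then have "t = s + of_int m" by simp
    then have "turn (H t) = turn (H s)" by (simp only: H_add_int turn_add_int)
    then show ?thesis by (simp add: h_def s_def)
  qed
  moreover have "continuous_on circle h" using h H_cont by (rule continuous_on_circle_of_lift)
  moreover have "h ` circle = circle"
    unfolding circle_eq_range_turn using h H_surj by (auto simp: image_iff) metis
  moreover have "h (f x) = rotation \<rho> (h x)" if "x \<in> circle" for x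
  proof -
    obtain t where t: "x = turn t" using \<open>x \<in> circle\<close> by (rule circle_turnE)
    have "h (f x) = turn (H t + \<rho>)" unfolding t turn_lift[symmetric] h H_F ..
    also have "\<dots> = turn \<rho> * turn (H t)" unfolding turn_add by (rule mult.commute)
    finally show ?thesis by (simp add: t h rotation_def)
  qed
  ultimately show thesis by (rule that)
qed

lemma semiconjugate: "semiconjugate_on circle f (rotation \<rho>)"
  unfolding semiconjugate_on_def using semiconjugacy by metis

lemma conjugate_of_inj:
  assumes "inj H"
  shows "conjugate_on circle f (rotation \<rho>)"
proof -
  obtain h where h: "\<And>t. h (turn t) = turn (H t)" "continuous_on circle h" "h ` circle = circle"
    "\<And>x. x \<in> circle \<Longrightarrow> h (f x) = rotation \<rho> (h x)" using semiconjugacy by blast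
  have "inj_on h circle"
  proof (rule inj_onI)
    fix x y assume xy: "x \<in> circle" "y \<in> circle" "h x = h y"
    obtain s where s: "x = turn s" using xy(1) by (rule circle_turnE)
    obtain t where t: "y = turn t" using xy(2) by (rule circle_turnE)
    have "turn (H s) = turn (H t)" using xy(3) h(1) s t by metis
    then obtain m where "H s - H t = of_int m" unfolding turn_eq_iff by (auto elim: Ints_cases)
    then have "H s = H (t + of_int m)" by (simp add: H_add_int)
    then have "s = t + of_int m" using injD[OF assms] by blast
    then show "x = y" unfolding s t by (simp only: turn_add_int)
  qed
  then obtain k where "homeomorphism circle circle h k"
    using homeomorphism_compact[of circle h circle] h(2,3) by auto
  then show ?thesis unfolding conjugate_on_def using h(4) by blast
qed

lemma nonwandering_of_inj:
  assumes "inj H"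
  shows "nonwandering circle f = circle"
proof
  show "circle \<subseteq> nonwandering circle f"
  proof
    fix z assume "z \<in> circle"
    then obtain t where t: "z = turn t" by (rule circle_turnE)
    have "H x < H t" if "x < t" for x
      using H_mono[of x t] injD[OF assms, of x t] that by (metis less_eq_real_def less_irrefl)
    then show "z \<in> nonwandering circle f" unfolding t by (rule nonwandering_of_left_increase)
  qed
qed (rule nonwandering_subset)


section \<open>Collapsed intervals force linear order on the nonwandering set\<close>

text \<open>
  A uniform modulus at scale \<open>1 / 2\<close>: arcs that are short enough cannot jump past half a turn in one step.
\<close>

lemma small_step:
  obtains \<delta> where "\<delta> > 0" "\<And>s t. s \<le> t \<Longrightarrow> t - s < \<delta> \<Longrightarrow> F t - F s < 1 / 2"
proof -
  have "uniformly_continuous_on {0..2} F" by (intro compact_uniformly_continuous cont) simp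
  moreover have "(1 / 2 :: real) > 0" by simp
  ultimately obtain d where d: "d > 0"
    "\<And>s t. \<lbrakk>s \<in> {0..2}; t \<in> {0..2}; dist t s < d\<rbrakk> \<Longrightarrow> dist (F t) (F s) < 1 / 2"
    unfolding uniformly_continuous_on_def by metis
  have "F t - F s < 1 / 2" if "s \<le> t" "t - s < min d 1" for s t
  proof -
    have "dist (F (t + of_int (- \<lfloor>s\<rfloor>))) (F (s + of_int (- \<lfloor>s\<rfloor>))) < 1 / 2"
    proof (rule d(2))
      show "s + of_int (- \<lfloor>s\<rfloor>) \<in> {0..2}" by simp linarith
      show "t + of_int (- \<lfloor>s\<rfloor>) \<in> {0..2}" using that by simp linarith
      show "dist (t + of_int (- \<lfloor>s\<rfloor>)) (s + of_int (- \<lfloor>s\<rfloor>)) < d"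
        using that by (simp add: dist_real_def)
    qed
    then show ?thesis
      unfolding add_int using abs_ge_self[of "F t - F s"] by (simp add: dist_real_def)
  qed
  with d(1) show thesis using that[of "min d 1"] by simp
qed

text \<open>
  The interval \<open>[X, Y]\<close> contains a collapsed interval which the \<open>i\<close>-th iterate carries to a translate of
  \<open>[a, b]\<close>. So its length reaches \<open>\<eta>\<close> by time \<open>i\<close>, and at the first such time it has not yet exceeded half
  a turn, so that the endpoints are far apart on the circle as well.
\<close>

lemma gap_stretches:
  assumes step: "\<And>s t. s \<le> t \<Longrightarrow> t - s < \<eta> \<Longrightarrow> F t - F s < 1 / 2"
    and gap: "\<eta> \<le> b - a" "H a = H b"
    and XY: "X < Y" "Y - X \<le> 1 / 2" "H X < H Y"
    and i: "(F ^^ i) X = a + of_int m"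
  obtains k where "k \<le> i" "\<eta> \<le> (F ^^ k) Y - (F ^^ k) X" "(F ^^ k) Y - (F ^^ k) X \<le> 1 / 2"
proof -
  have "H ((F ^^ i) X) < H ((F ^^ i) Y)" using XY(3) by (simp add: H_funpow)
  moreover have "H ((F ^^ i) X) = H (b + of_int m)" unfolding i H_add_int gap(2) ..
  ultimately have "b + of_int m < (F ^^ i) Y" by (simp add: H_less_imp_less)
  then have reach: "\<eta> \<le> (F ^^ i) Y - (F ^^ i) X" using gap(1) i by simp
  define k where "k = (LEAST k. \<eta> \<le> (F ^^ k) Y - (F ^^ k) X)"
  have k: "\<eta> \<le> (F ^^ k) Y - (F ^^ k) X" unfolding k_def by (rule LeastI) (rule reach)
  have ki: "k \<le> i" unfolding k_def by (rule Least_le) (rule reach)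
  have "(F ^^ k) Y - (F ^^ k) X \<le> 1 / 2"
  proof (cases k)
    case 0 then show ?thesis using XY(2) by simp
  next
    case (Suc l)
    then have "\<not> \<eta> \<le> (F ^^ l) Y - (F ^^ l) X"
      unfolding k_def by (intro not_less_Least) simp
    then show ?thesis
      using step[of "(F ^^ l) X" "(F ^^ l) Y"] funpow_le_iff[of l X Y] XY(1) Suc by simp
  qed
  with ki k show thesis by (rule that)
qed

text \<open>
  The left end of a maximal interval of constancy.
\<close>

lemma gap_left_end:
  assumes "\<not> inj H"
  obtains a b where "a < b" "H a = H b" "\<And>x. x < a \<Longrightarrow> H x < H a"
proof -
  obtain s t where st: "H s = H t" "s < t"
    using assms unfolding inj_def by (metis linorder_neqE_linordered_idom)
  define A where "A = {x. H x = H t}"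
  define a where "a = Inf A"
  have "closed A" unfolding A_def
    by (intro closed_Collect_eq H_cont continuous_on_const)
  moreover have "s \<in> A" using st by (simp add: A_def)
  moreover have bdd: "bdd_below A"
  proof
    fix x assume "x \<in> A"
    then show "H t - 2 \<le> x" using abs_H_minus_le[of x] by (simp add: A_def)
  qed
  ultimately have "a \<in> A" unfolding a_def by (intro closed_contains_Inf) auto
  then have "H a = H t" by (simp add: A_def)
  moreover have "a < t" using cInf_lower[OF \<open>s \<in> A\<close> bdd] st(2) by (simp add: a_def)
  moreover have "H x < H a" if "x < a" for x
  proof -
    have "x \<notin> A" using cInf_lower[OF _ bdd, of x] that by (auto simp: a_def)
    then show ?thesis using H_mono[of x a] that \<open>H a = H t\<close> by (auto simp: A_def)
  qed
  ultimately show thesis by (intro that)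
qed

text \<open>
  The separated points are the preimages \<open>X j\<close> of the left end \<open>a\<close> of a collapsed interval. They are
  nonwandering, which is why the bound holds on every set between the nonwandering set and the circle.
\<close>

lemma gen_entropy_of_not_inj:
  assumes "\<not> inj H" and M: "nonwandering circle f \<subseteq> M" "M \<subseteq> circle"
  shows "gen_entropy M f = order_linear"
proof -
  obtain a b where ab: "a < b" "H a = H b" "\<And>x. x < a \<Longrightarrow> H x < H a"
    using gap_left_end[OF assms(1)] by blast
  obtain \<delta> where \<delta>: "\<delta> > 0" "\<And>s t. s \<le> t \<Longrightarrow> t - s < \<delta> \<Longrightarrow> F t - F s < 1 / 2"
    using small_step by blast
  define \<eta> where "\<eta> = min (1 / 2) (min \<delta> (b - a))"
  have \<eta>: "0 < \<eta>" "\<eta> \<le> 1 / 2" "\<eta> \<le> \<delta>" "\<eta> \<le> b - a" using \<delta>(1) ab(1) unfolding \<eta>_def by linarith+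
  obtain X where X: "\<And>j. (F ^^ j) (X j) = a" using funpow_surj[of _ a] by metis
  have HX: "H (X j) = H a - real j * \<rho>" for j using H_funpow[of j "X j"] X[of j] by simp
  have "turn (X j) \<in> nonwandering circle f" for j
  proof (rule nonwandering_of_left_increase)
    fix x assume "x < X j"
    then have "(F ^^ j) x < a" using funpow_less_iff[of j x "X j"] X[of j] by simp
    then have "H ((F ^^ j) x) < H a" by (rule ab(3))
    then show "H x < H (X j)" by (simp add: H_funpow HX)
  qed
  then have in_M: "turn (X j) \<in> M" for j using M(1) by blast
  have far: "2 * sin (pi * \<eta>) \<le> bowen_dist f n (turn x) (turn y)"
    if xy: "x < y" "y - x \<le> 1 / 2" "H x \<noteq> H y" and i: "(F ^^ i) x = a + of_int m" "i \<le> n"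
    for x y i m n
  proof -
    have "H x < H y" using H_mono[of x y] xy(1,3) by simp
    have step: "F t - F s < 1 / 2" if "s \<le> t" "t - s < \<eta>" for s t
      using \<delta>(2) \<eta>(3) that by simp
    obtain k where k: "k \<le> i" "\<eta> \<le> (F ^^ k) y - (F ^^ k) x" "(F ^^ k) y - (F ^^ k) x \<le> 1 / 2"
      using gap_stretches[OF step \<eta>(4) ab(2) xy(1,2) \<open>H x < H y\<close> i(1)] .
    have "2 * sin (pi * \<eta>) \<le> dist (turn ((F ^^ k) x)) (turn ((F ^^ k) y))"
      using \<eta>(1) k(2,3) by (intro dist_turn_ge) auto
    also have "\<dots> \<le> bowen_dist f n (turn x) (turn y)"
      unfolding turn_lift_funpow using k(1) i(2) by (intro dist_iterate_le_bowen_dist) simp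
    finally show ?thesis .
  qed
  show ?thesis
  proof (rule gen_entropy_linear_of_separated[OF homeo M(2) _ in_M])
    show "0 < 2 * sin (pi * \<eta>)" using sin_pi_pos[OF \<eta>(1,2)] by simp
    fix i j n :: nat assume ij: "i \<le> n" "j \<le> n" "i \<noteq> j"
    \<comment> \<open>Move \<open>X j\<close> by an integer so that the two lifts are at most half a turn apart; whichever of
    them is on the left supplies the collapsed interval.\<close>
    define m where "m = round (X i - X j)"
    define Y where "Y = X j + of_int m"
    have turn_Y: "turn Y = turn (X j)" unfolding Y_def by (rule turn_add_int)
    have close: "\<bar>X i - Y\<bar> \<le> 1 / 2"
      using of_int_round_abs_le[of "X i - X j"] unfolding Y_def m_def by linarith
    have ne: "H (X i) \<noteq> H Y"
    proof
      assume "H (X i) = H Y"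
      moreover have "H Y = H a - real j * \<rho> + of_int m" unfolding Y_def H_add_int HX ..
      ultimately have "(real j - real i) * \<rho> = of_int m" by (simp add: HX algebra_simps)
      then have "\<rho> = of_int m / (real j - real i)" using ij(3) by (simp add: field_simps)
      then have "\<rho> \<in> \<rat>" by simp
      with irrational show False ..
    qed
    have iX: "(F ^^ i) (X i) = a + of_int 0" and iY: "(F ^^ j) Y = a + of_int m"
      by (simp_all add: X Y_def funpow_add_int)
    show "2 * sin (pi * \<eta>) \<le> bowen_dist f n (turn (X i)) (turn (X j))"
    proof (cases "X i < Y")
      case True
      then show ?thesis using far[OF True _ ne iX ij(1)] close turn_Y by simp
    next
      case False
      then have "Y < X i" using ne by (metis linorder_neqE_linordered_idom)
      then show ?thesis
        using far[OF \<open>Y < X i\<close> _ ne[symmetric] iY ij(2)] close turn_Y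
        by (simp add: bowen_dist_commute)
    qed
  qed
qed

lemma entropy_numbers_of_not_inj:
  assumes "\<not> inj H"
  shows "entropy_numbers circle f = (order_linear, order_linear)"
  unfolding entropy_numbers_def
  by (simp add: gen_entropy_of_not_inj[OF assms] nonwandering_subset)

end


section \<open>The three categories and their comparison\<close>

text \<open>
  Rotations are isometries, and the conjugacy and its inverse are uniformly continuous.
\<close>

lemma lyapunov_stable_of_conjugate_rotation:
  assumes "circle_homeo f" "conjugate_on circle f (rotation \<rho>)"
  shows "lyapunov_stable circle f"
proof -
  obtain h k where hk: "homeomorphism circle circle h k"
    and conj: "\<And>x. x \<in> circle \<Longrightarrow> h (f x) = rotation \<rho> (h x)"
    using assms(2) unfolding conjugate_on_def by blast
  have iter: "h ((f ^^ n) x) = turn \<rho> ^ n * h x" if "x \<in> circle" for x n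
    using conj funpow_in_circle[OF assms(1) that]
    by (induction n) (simp_all add: rotation_def mult.assoc)
  have iterate: "(f ^^ n) x = k (turn \<rho> ^ n * h x)" if "x \<in> circle" for x n
    using iter[OF that] homeomorphism_apply1[OF hk funpow_in_circle[OF assms(1) that]] by metis
  have h_circle: "h x \<in> circle" if "x \<in> circle" for x
    using hk that by (auto simp: homeomorphism_def)
  have comp: "compact circle" by simp
  have uh: "uniformly_continuous_on circle h" and uk: "uniformly_continuous_on circle k"
    using hk comp by (auto simp: homeomorphism_def intro!: compact_uniformly_continuous)
  show ?thesis
    unfolding lyapunov_stable_def
  proof (intro allI impI)
    fix \<epsilon> :: real assume "\<epsilon> > 0"
    then obtain d where d: "d > 0"
      "\<And>u v. \<lbrakk>u \<in> circle; v \<in> circle; dist u v < d\<rbrakk> \<Longrightarrow> dist (k u) (k v) < \<epsilon>"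
      using uk unfolding uniformly_continuous_on_def by metis
    obtain \<delta> where \<delta>: "\<delta> > 0"
      "\<And>x y. \<lbrakk>x \<in> circle; y \<in> circle; dist x y < \<delta>\<rbrakk> \<Longrightarrow> dist (h x) (h y) < d"
      using uh d(1) unfolding uniformly_continuous_on_def by metis
    have "dist ((f ^^ n) x) ((f ^^ n) y) < \<epsilon>"
      if xy: "x \<in> circle" "y \<in> circle" "dist x y < \<delta>" for x y n
    proof -
      have "norm (turn \<rho> ^ n) = 1" by (simp add: norm_power)
      then have "dist (turn \<rho> ^ n * h x) (turn \<rho> ^ n * h y) = dist (h x) (h y)"
        by (simp add: dist_norm norm_mult flip: right_diff_distrib)
      moreover have "turn \<rho> ^ n * h z \<in> circle" if "z \<in> circle" for z
        using h_circle[OF that] by (simp add: norm_mult norm_power)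
      ultimately show ?thesis using d(2) \<delta>(2)[OF xy] xy(1,2) by (simp add: iterate)
    qed
    with \<delta>(1) show "\<exists>\<delta>>0. \<forall>x\<in>circle. \<forall>y\<in>circle. dist x y < \<delta> \<longrightarrow>
        (\<forall>n\<ge>1. dist ((f ^^ n) x) ((f ^^ n) y) < \<epsilon>)" by blast
  qed
qed

lemma lyapunov_stable_imp_gen_entropy_circle:
  "lyapunov_stable circle f \<Longrightarrow> gen_entropy circle f = order_zero"
  using lyapunov_stable_imp_gen_entropy_zero[of circle circle f] by simp

lemma entropy_numbers_of_aperiodic:
  assumes "circle_homeo f" "\<not> has_periodic_points circle f"
  shows "entropy_numbers circle f = (order_zero, order_zero) \<and> lyapunov_stable circle f \<or>
         entropy_numbers circle f = (order_linear, order_linear) \<and> denjoy_map f"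
proof -
  obtain F where "increasing_lift f F" using increasing_lift_exists[OF assms] .
  then interpret increasing_lift f F .
  obtain \<rho> where dev: "\<And>n t. \<bar>(F ^^ n) t - t - real n * \<rho>\<bar> \<le> 2"
    using rotation_number_exists by blast
  have irr: "\<rho> \<notin> \<rat>" using dev assms(2) by (rule rotation_number_irrational)
  interpret irrational_lift f F \<rho> using dev irr by unfold_locales
  show ?thesis
  proof (cases "inj H")
    case True
    have "lyapunov_stable circle f"
      using assms(1) conjugate_of_inj[OF True] by (rule lyapunov_stable_of_conjugate_rotation)
    then show ?thesis
      using lyapunov_stable_imp_gen_entropy_circle nonwandering_of_inj[OF True]
      by (simp add: entropy_numbers_def)
  next
    case False
    have linear: "entropy_numbers circle f = (order_linear, order_linear)"
      using False by (rule entropy_numbers_of_not_inj)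
    have "\<not> conjugate_on circle f (rotation \<rho>)"
    proof
      assume "conjugate_on circle f (rotation \<rho>)"
      with assms(1) have "lyapunov_stable circle f" by (rule lyapunov_stable_of_conjugate_rotation)
      then have "gen_entropy circle f = order_zero" by (rule lyapunov_stable_imp_gen_entropy_circle)
      with linear show False using order_zero_neq_order_linear by (simp add: entropy_numbers_def)
    qed
    moreover have "has_rotation_number f \<rho>"
      unfolding has_rotation_number_def using lift strict funpow_over_n_tendsto[OF dev] by blast
    moreover have "orientation_preserving f"
      unfolding orientation_preserving_def using lift strict by blast
    ultimately have "denjoy_map f"
      unfolding denjoy_map_def using assms(1) irr semiconjugate by blast
    with linear show ?thesis by blast
  qed
qed

text \<open>
  The limit of \<open>F\<^sup>n t / n\<close> identifies the given rotation number with the one for which the deviation bound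
  holds. So if the monotone semiconjugacy \<open>H\<close> of this lift were injective, \<open>f\<close> would be conjugate to exactly
  the rotation excluded by the definition.
\<close>

lemma entropy_numbers_of_denjoy:
  assumes "denjoy_map f"
  shows "entropy_numbers circle f = (order_linear, order_linear)"
proof -
  obtain \<rho> F where homeo: "circle_homeo f" and irr: "\<rho> \<notin> \<rat>"
    and not_conj: "\<not> conjugate_on circle f (rotation \<rho>)"
    and F: "is_lift F f" "strict_mono F" "\<And>t. (\<lambda>n. (F ^^ n) t / real n) \<longlonglongrightarrow> \<rho>"
    using assms unfolding denjoy_map_def has_rotation_number_def by blast
  interpret increasing_lift f F using homeo F by unfold_locales
  obtain \<rho>' where dev: "\<And>n t. \<bar>(F ^^ n) t - t - real n * \<rho>'\<bar> \<le> 2"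
    using rotation_number_exists by blast
  have "\<rho>' = \<rho>" using funpow_over_n_tendsto[OF dev, of 0] F(3)[of 0] by (rule LIMSEQ_unique)
  then interpret irrational_lift f F \<rho> using dev irr by unfold_locales auto
  show ?thesis
    using conjugate_of_inj not_conj entropy_numbers_of_not_inj by blast
qed

lemma circle_trichotomy:
  assumes "circle_homeo f"
  shows "entropy_numbers circle f = (order_zero, order_zero) \<and> lyapunov_stable circle f \<or>
         entropy_numbers circle f = (order_zero, order_linear) \<and>
           \<not> lyapunov_stable circle f \<and> has_periodic_points circle f \<or>
         entropy_numbers circle f = (order_linear, order_linear) \<and> denjoy_map f"
  using entropy_numbers_of_periodic[OF assms] entropy_numbers_of_aperiodic[OF assms] by blast

text \<open>
  The empty set has to be treated separately: its spanning numbers vanish, so its order is strictly below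
  \<open>order_zero\<close>.
\<close>

lemma gen_entropy_finite_neq_linear:
  assumes "finite M"
  shows "gen_entropy M f \<noteq> order_linear"
proof (cases "M = {}")
  case False
  have "\<exists>E. spanning_set M f \<epsilon> n E \<and> card E \<le> card M" if "\<epsilon> > 0" for \<epsilon> n
  proof -
    have "bowen_dist f n x x \<le> \<epsilon>" for x using \<open>\<epsilon> > 0\<close> by (simp add: bowen_dist_le_iff)
    then have "spanning_set M f \<epsilon> n M" using assms by (auto simp: spanning_set_iff)
    then show ?thesis by blast
  qed
  then have "gen_entropy M f = order_zero" using False by (intro gen_entropy_eq_zeroI) blast+
  then show ?thesis using order_zero_neq_order_linear by simp
next
  case True
  have "spanning_set {} f \<epsilon> n {}" for \<epsilon> n by (simp add: spanning_set_iff)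
  then have "spanning_number {} f \<epsilon> n = 0" for \<epsilon> n
    using spanning_number_le_card[of "{}" f \<epsilon> n "{}"] by simp
  then have "gen_entropy {} f \<le> order_zero"
    unfolding gen_entropy_def order_zero_def using const_in_growth_seqs[of 0] one_growth
    by (intro Sup_least) (auto simp: dm_embed_le_iff growth_class_le_iff growth_le_def intro: exI[of _ 1])
  then show ?thesis unfolding True using order_zero_less_order_linear by auto
qed

text \<open>
  Finiteness of the nonwandering set excludes linear order there and, the circle being infinite, yields a
  wandering point.
\<close>

lemma entropy_numbers_of_morse_smale:
  assumes "morse_smale g"
  shows "entropy_numbers circle g = (order_zero, order_linear)"
proof -
  have homeo: "circle_homeo g" and fin: "finite (nonwandering circle g)"
    using assms by (auto simp: morse_smale_def)
  have "infinite circle"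
  proof
    assume "finite circle"
    then have "finite (turn ` {0..<1})" by (rule finite_subset[rotated]) auto
    moreover have "inj_on turn {0..<1}"
    proof (rule inj_onI)
      fix s t assume "s \<in> {0..<1}" "t \<in> {0..<1}" "turn s = turn t"
      then show "s = t" using Ints_nonzero_abs_less1[of "s - t"] by (auto simp: turn_eq_iff)
    qed
    ultimately have "finite {0..<1::real}" by (rule finite_imageD)
    then show False using infinite_Ico[of 0 "1::real"] by simp
  qed
  then have "\<not> circle \<subseteq> nonwandering circle g" using finite_subset[OF _ fin] by metis
  then obtain x where x: "x \<in> circle" "x \<notin> nonwandering circle g" unfolding subset_iff by metis
  have "gen_entropy circle g = order_linear"
    using homeo x by (rule gen_entropy_linear_of_wandering)
  then show ?thesis
    using circle_trichotomy[OF homeo] gen_entropy_finite_neq_linear[OF fin, of g]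
      order_zero_neq_order_linear by (auto simp: entropy_numbers_def)
qed

text \<open>
  Being Lyapunov stable, a rotation falls into the first of the three categories, the only one with order \<open>0\<close>
  on the circle.
\<close>

lemma entropy_numbers_of_rotation:
  assumes "is_rotation r"
  shows "entropy_numbers circle r = (order_zero, order_zero)"
proof -
  obtain \<alpha> where \<alpha>: "\<And>z. z \<in> circle \<Longrightarrow> r z = rotation \<alpha> z"
    using assms unfolding is_rotation_def by blast
  have inv: "turn \<alpha> * turn (- \<alpha>) = 1" using turn_add[of \<alpha> "- \<alpha>"] by simp
  have "homeomorphism circle circle r (rotation (- \<alpha>))"
  proof (rule homeomorphismI)
    show "continuous_on circle r"
      using \<alpha> by (subst continuous_on_cong[OF refl \<alpha>]) (auto simp: rotation_def intro!: continuous_intros)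
    show "continuous_on circle (rotation (- \<alpha>))"
      unfolding rotation_def by (intro continuous_intros)
    show "r ` circle \<subseteq> circle" using \<alpha> by (auto simp: rotation_def norm_mult)
    show "rotation (- \<alpha>) ` circle \<subseteq> circle" by (auto simp: rotation_def norm_mult)
    show "rotation (- \<alpha>) (r x) = x" if "x \<in> circle" for x
      using \<alpha>[OF that] inv by (simp add: rotation_def mult.commute mult.left_commute)
    show "r (rotation (- \<alpha>) y) = y" if "y \<in> circle" for y
    proof -
      have "rotation (- \<alpha>) y \<in> circle" using that by (simp add: rotation_def norm_mult)
      then show ?thesis using \<alpha> inv by (simp add: rotation_def mult.commute mult.left_commute)
    qed
  qed
  then have homeo: "circle_homeo r" unfolding circle_homeo_def by blast
  have "homeomorphism circle circle id (id :: complex \<Rightarrow> complex)"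
    by (auto simp: homeomorphism_def)
  then have "conjugate_on circle r (rotation \<alpha>)"
    unfolding conjugate_on_def using \<alpha> by (metis id_apply)
  with homeo have "lyapunov_stable circle r" by (rule lyapunov_stable_of_conjugate_rotation)
  moreover from this have "gen_entropy circle r = order_zero"
    by (rule lyapunov_stable_imp_gen_entropy_circle)
  ultimately show ?thesis
    using circle_trichotomy[OF homeo] order_zero_neq_order_linear by (auto simp: entropy_numbers_def)
qed

theorem theorem4:
  shows "(\<forall>f. circle_homeo f \<longrightarrow>
            entropy_numbers circle f = (order_zero, order_zero) \<and> lyapunov_stable circle f \<or>
            entropy_numbers circle f = (order_zero, order_linear) \<and>
              \<not> lyapunov_stable circle f \<and> has_periodic_points circle f \<or>
            entropy_numbers circle f = (order_linear, order_linear) \<and> denjoy_map f)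
       \<and> (\<forall>f g. denjoy_map f \<and> morse_smale g \<longrightarrow> more_dispersive circle f g)
       \<and> (\<forall>g r. morse_smale g \<and> is_rotation r \<longrightarrow> more_dispersive circle g r)"
proof (intro conjI allI impI; (elim conjE)?)
  fix f assume "circle_homeo f"
  then show "entropy_numbers circle f = (order_zero, order_zero) \<and> lyapunov_stable circle f \<or>
            entropy_numbers circle f = (order_zero, order_linear) \<and>
              \<not> lyapunov_stable circle f \<and> has_periodic_points circle f \<or>
            entropy_numbers circle f = (order_linear, order_linear) \<and> denjoy_map f"
    by (rule circle_trichotomy)
next
  fix f g assume "denjoy_map f" "morse_smale g"
  then show "more_dispersive circle f g"
    using entropy_numbers_of_denjoy[of f] entropy_numbers_of_morse_smale[of g]
      order_zero_less_order_linear by (simp add: more_dispersive_def entropy_numbers_def)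
next
  fix g r assume "morse_smale g" "is_rotation r"
  then show "more_dispersive circle g r"
    using entropy_numbers_of_morse_smale[of g] entropy_numbers_of_rotation[of r]
      order_zero_less_order_linear by (simp add: more_dispersive_def entropy_numbers_def)
qed

end
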